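(* Let $\mathscr U$ be a countably incomplete ultrafilter on a set $I$, let $\lambda\ge 1$, and let $(X_i)_{i\in I}$ be a family of Banach spaces such that the ultraproduct $[X_i]_{\mathscr U}$ is an $\mathcal L_{\infty,\lambda^+}$-space. Then $[X_i]_{\mathscr U}$ is $\lambda$-universally separably injective.
   Context: "Operator" means bounded linear map; "subspace" means closed linear subspace. An ultrafilter $\mathscr U$ on $I$ is countably incomplete if there is a decreasing sequence $(I_n)$ of subsets of $I$ with $I_n\in\mathscr U$ for all $n$ and $\bigcap_n I_n=\varnothing$. The ultraproduct is the quotient Banach space $[X_i]_{\mathscr U}=\ell_\infty(X_i)/c_0^{\mathscr U}(X_i)$, where $\ell_\infty(X_i)$ is the space of bounded families $(x_i)_{i\in I}$, $x_i\in X_i$, with the sup norm, and $c_0^{\mathscr U}(X_i)=\{(x_i)\in\ell_\infty(X_i):\lim_{\mathscr U(i)}\|x_i\|=0\}$. A Banach space $X$ is an $\mathcal L_{\infty,\mu}$-space if every finite-dimensional subspace of $X$ is contained in another finite-dimensional subspace $F$ of $X$ whose Banach-Mazur distance to $\ell_\infty^{\dim F}$ is at most $\mu$; it is an $\mathcal L_{\infty,\lambda^+}$-space if it is an $\mathcal L_{\infty,\mu}$-space for all $\mu>\lambda$. A Banach space $E$ is $\lambda$-universally separably injective if for every Banach space $X$ and each separable subspace $Y\subset X$, every operator $t:Y\to E$ extends to an operator $T:X\to E$ with $\|T\|\le\lambda\|t\|$. *)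

theory Defs
  imports "HOL-Analysis.Analysis" "HOL-Algebra.Module" "HOL-Algebra.AbelCoset"
begin

section \<open>Scalars\<close>

text \<open>The ground field is real or complex, simultaneously: up to isometric isomorphism,
  the types of this class are exactly the real and the complex numbers.\<close>

class real_or_complex = real_normed_field +
  assumes embeds_in_complex:
    "\<exists>f :: 'a \<Rightarrow> complex. f 1 = 1 \<and> (\<forall>x y. f (x + y) = f x + f y) \<and> (\<forall>x y. f (x * y) = f x * f y)
       \<and> (\<forall>x. norm (f x) = norm x) \<and> (range f = \<real> \<or> range f = UNIV)"

instance real :: real_or_complex
  by standard (rule exI[of _ complex_of_real], auto simp: Reals_def)

instance complex :: real_or_complex
  by standard (rule exI[of _ "\<lambda>z. z"], auto)

definition scalar_ring :: "('k::real_normed_field) ring" where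
  "scalar_ring = \<lparr>carrier = UNIV, monoid.mult = (*), monoid.one = 1, ring.zero = 0, ring.add = (+)\<rparr>"


section \<open>Normed and Banach spaces with explicit carriers\<close>

text \<open>The ultraproduct of a family depends on a filter and on a family of spaces, so it cannot be
  a type; spaces are therefore records extending the modules of HOL-Algebra by a norm.
  The ring fields \<open>mult\<close> and \<open>one\<close> inherited from that record type play no role for modules.\<close>

record ('k, 'v) nspace = "('k, 'v) module" +
  vnorm :: "'v \<Rightarrow> real"

locale normed_space = V?: module scalar_ring V
  for V :: "('k::real_normed_field, 'v) nspace" (structure) +
  assumes vnorm_eq_0_iff: "x \<in> carrier V \<Longrightarrow> vnorm V x = 0 \<longleftrightarrow> x = \<zero>"
    and vnorm_triangle: "x \<in> carrier V \<Longrightarrow> y \<in> carrier V \<Longrightarrow> vnorm V (x \<oplus> y) \<le> vnorm V x + vnorm V y"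
    and vnorm_smult: "x \<in> carrier V \<Longrightarrow> vnorm V (c \<odot> x) = norm c * vnorm V x"

text \<open>The locale \<^locale>\<open>Metric_space\<close> requires nonnegativity and symmetry also off the carrier.\<close>

definition vdist :: "('k, 'v) nspace \<Rightarrow> 'v \<Rightarrow> 'v \<Rightarrow> real" where
  "vdist V x y = (if x \<in> carrier V \<and> y \<in> carrier V then vnorm V (x \<ominus>\<^bsub>V\<^esub> y) else 0)"

definition vtopology :: "('k, 'v) nspace \<Rightarrow> 'v topology" where
  "vtopology V = Metric_space.mtopology (carrier V) (vdist V)"

definition banach_space :: "('k::real_normed_field, 'v) nspace \<Rightarrow> bool" where
  "banach_space V \<longleftrightarrow> normed_space V \<and> Metric_space.mcomplete (carrier V) (vdist V)"

definition closed_subspace :: "'v set \<Rightarrow> ('k::real_normed_field, 'v) nspace \<Rightarrow> bool" where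
  "closed_subspace M V \<longleftrightarrow> submodule M scalar_ring V \<and> closedin (vtopology V) M"

abbreviation subspace_of :: "('k, 'v) nspace \<Rightarrow> 'v set \<Rightarrow> ('k, 'v) nspace" where
  "subspace_of V M \<equiv> V\<lparr>carrier := M\<rparr>"


section \<open>Bounded operators\<close>

definition operator :: "('k, 'v) nspace \<Rightarrow> ('k, 'w) nspace \<Rightarrow> ('v \<Rightarrow> 'w) \<Rightarrow> bool" where
  "operator V W T \<longleftrightarrow> T \<in> carrier V \<rightarrow> carrier W
     \<and> (\<forall>x\<in>carrier V. \<forall>y\<in>carrier V. T (x \<oplus>\<^bsub>V\<^esub> y) = T x \<oplus>\<^bsub>W\<^esub> T y)
     \<and> (\<forall>c. \<forall>x\<in>carrier V. T (c \<odot>\<^bsub>V\<^esub> x) = c \<odot>\<^bsub>W\<^esub> T x)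
     \<and> (\<exists>K. \<forall>x\<in>carrier V. vnorm W (T x) \<le> K * vnorm V x)"

definition opnorm :: "('k, 'v) nspace \<Rightarrow> ('k, 'w) nspace \<Rightarrow> ('v \<Rightarrow> 'w) \<Rightarrow> real" where
  "opnorm V W T = (SUP x\<in>{x \<in> carrier V. vnorm V x \<le> 1}. vnorm W (T x))"

text \<open>The Banach-Mazur distance; it is infinite if the two spaces are not isomorphic.\<close>

definition bm_dist :: "('k, 'v) nspace \<Rightarrow> ('k, 'w) nspace \<Rightarrow> ereal" where
  "bm_dist V W = (INF (T, S)\<in>{(T, S). operator V W T \<and> operator W V S
       \<and> (\<forall>x\<in>carrier V. S (T x) = x) \<and> (\<forall>y\<in>carrier W. T (S y) = y)}.
     ereal (opnorm V W T * opnorm W V S))"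


section \<open>Dimension\<close>

definition vspan :: "('k::real_normed_field, 'v) nspace \<Rightarrow> 'v set \<Rightarrow> 'v set" where
  "vspan V B = \<Inter>{L. submodule L scalar_ring V \<and> B \<subseteq> L}"

definition vbasis :: "('k::real_normed_field, 'v) nspace \<Rightarrow> 'v set \<Rightarrow> bool" where
  "vbasis V B \<longleftrightarrow> B \<subseteq> carrier V \<and> (\<forall>b\<in>B. b \<notin> vspan V (B - {b})) \<and> vspan V B = carrier V"

definition finite_dimensional :: "('k::real_normed_field, 'v) nspace \<Rightarrow> bool" where
  "finite_dimensional V \<longleftrightarrow> (\<exists>B. finite B \<and> vbasis V B)"

definition vdim :: "('k::real_normed_field, 'v) nspace \<Rightarrow> nat" where
  "vdim V = card (SOME B. vbasis V B)"


section \<open>Bounded families, quotients and ultraproducts\<close>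

text \<open>Inserting \<open>0\<close> only matters for the empty index set, i.e. for the zero-dimensional
  space \<open>\<ell>\<^sub>\<infinity>\<^sup>0\<close>.\<close>

definition ell_inf :: "'i set \<Rightarrow> ('i \<Rightarrow> ('k, 'v) nspace) \<Rightarrow> ('k, 'i \<Rightarrow> 'v) nspace" where
  "ell_inf I X = \<lparr>carrier = {x \<in> (\<Pi>\<^sub>E i\<in>I. carrier (X i)). bdd_above ((\<lambda>i. vnorm (X i) (x i)) ` I)},
     monoid.mult = undefined, monoid.one = undefined,
     ring.zero = (\<lambda>i\<in>I. \<zero>\<^bsub>X i\<^esub>),
     ring.add = (\<lambda>x y. \<lambda>i\<in>I. x i \<oplus>\<^bsub>X i\<^esub> y i),
     smult = (\<lambda>c x. \<lambda>i\<in>I. c \<odot>\<^bsub>X i\<^esub> x i),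
     vnorm = (\<lambda>x. Sup (insert 0 ((\<lambda>i. vnorm (X i) (x i)) ` I)))\<rparr>"

definition scalar_space :: "('k::real_normed_field, 'k) nspace" where
  "scalar_space = \<lparr>carrier = UNIV, monoid.mult = (*), monoid.one = 1, ring.zero = 0, ring.add = (+),
     smult = (*), vnorm = norm\<rparr>"

definition ell_inf_n :: "nat \<Rightarrow> ('k::real_normed_field, nat \<Rightarrow> 'k) nspace" where
  "ell_inf_n n = ell_inf {..<n} (\<lambda>_. scalar_space)"

text \<open>The scalar multiple of a coset is a union of cosets, as for quotient rings in HOL-Algebra, since
  \<open>0\<close> times a coset must be \<open>M\<close> itself.\<close>

definition quotient_space :: "('k, 'v) nspace \<Rightarrow> 'v set \<Rightarrow> ('k, 'v set) nspace" where
  "quotient_space V M = \<lparr>carrier = a_rcosets\<^bsub>V\<^esub> M,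
     monoid.mult = undefined, monoid.one = undefined,
     ring.zero = M,
     ring.add = set_add V,
     smult = (\<lambda>c C. \<Union>x\<in>C. M +>\<^bsub>V\<^esub> (c \<odot>\<^bsub>V\<^esub> x)),
     vnorm = (\<lambda>C. INF x\<in>C. vnorm V x)\<rparr>"

text \<open>Ultrafilters on the set \<open>I\<close> are the filters on the ambient type that contain \<open>I\<close> and are
  maximal among proper filters.\<close>

definition ultrafilter_on :: "'i set \<Rightarrow> 'i filter \<Rightarrow> bool" where
  "ultrafilter_on I U \<longleftrightarrow> U \<noteq> bot \<and> U \<le> principal I
     \<and> (\<forall>P. eventually P U \<or> eventually (\<lambda>i. \<not> P i) U)"

definition countably_incomplete :: "'i set \<Rightarrow> 'i filter \<Rightarrow> bool" where
  "countably_incomplete I U \<longleftrightarrow> (\<exists>J :: nat \<Rightarrow> 'i set. decseq J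
     \<and> (\<forall>n. J n \<subseteq> I \<and> eventually (\<lambda>i. i \<in> J n) U) \<and> (\<Inter>n. J n) = {})"

definition c0_along :: "'i filter \<Rightarrow> 'i set \<Rightarrow> ('i \<Rightarrow> ('k, 'v) nspace) \<Rightarrow> ('i \<Rightarrow> 'v) set" where
  "c0_along U I X = {x \<in> carrier (ell_inf I X). ((\<lambda>i. vnorm (X i) (x i)) \<longlongrightarrow> 0) U}"

definition ultraproduct :: "'i filter \<Rightarrow> 'i set \<Rightarrow> ('i \<Rightarrow> ('k, 'v) nspace) \<Rightarrow> ('k, ('i \<Rightarrow> 'v) set) nspace"
  where "ultraproduct U I X = quotient_space (ell_inf I X) (c0_along U I X)"


section \<open>The classes of Banach spaces\<close>

definition script_L_inf :: "real \<Rightarrow> ('k::real_normed_field, 'v) nspace \<Rightarrow> bool" where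
  "script_L_inf \<mu> V \<longleftrightarrow> banach_space V
     \<and> (\<forall>G. closed_subspace G V \<and> finite_dimensional (subspace_of V G) \<longrightarrow>
          (\<exists>F. closed_subspace F V \<and> finite_dimensional (subspace_of V F) \<and> G \<subseteq> F
             \<and> bm_dist (subspace_of V F) (ell_inf_n (vdim (subspace_of V F))) \<le> ereal \<mu>))"

definition script_L_inf_plus :: "real \<Rightarrow> ('k::real_normed_field, 'v) nspace \<Rightarrow> bool" where
  "script_L_inf_plus r V \<longleftrightarrow> (\<forall>\<mu>>r. script_L_inf \<mu> V)"

text \<open>HOL cannot quantify over types inside a formula, so the type \<open>'x\<close> in which the test spaces
  live is a parameter; a theorem with a free type variable in its place speaks about all
  Banach spaces.\<close>

definition universally_separably_injective ::
    "'x itself \<Rightarrow> real \<Rightarrow> ('k::real_normed_field, 'v) nspace \<Rightarrow> bool" where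
  "universally_separably_injective (_ :: 'x itself) r E \<longleftrightarrow> banach_space E
     \<and> (\<forall>(X :: ('k, 'x) nspace) Y t. banach_space X \<and> closed_subspace Y X
          \<and> separable_space (subtopology (vtopology X) Y) \<and> operator (subspace_of X Y) E t \<longrightarrow>
          (\<exists>T. operator X E T \<and> (\<forall>y\<in>Y. T y = t y)
             \<and> opnorm X E T \<le> r * opnorm (subspace_of X Y) E t))"

end

theory Submission
  imports Defs
begin

text \<open>Let \<open>t : Y \<rightarrow> E\<close> with \<open>E\<close> the ultraproduct and \<open>(y\<^sub>n)\<close> dense in \<open>Y\<close>. The span of
  \<open>t y\<^sub>0, \<dots>, t y\<^sub>n\<close> lies in a subspace \<open>F\<close> that is almost \<open>r\<close>-isomorphic to some \<open>\<ell>\<^sub>\<infinity>\<^sup>k\<close>, so by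
  Hahn-Banach, applied to the \<open>k\<close> coordinates on \<open>{y \<in> Y. t y \<in> F}\<close>, \<open>t\<close> extends from
  there to the whole space with values in \<open>F\<close> and norm almost \<open>r \<parallel>t\<parallel>\<close>. Lifting the \<open>k\<close> basis
  vectors of \<open>F\<close> to bounded families gives linear maps \<open>\<tau>\<^sub>n\<^sub>,\<^sub>i\<close> into \<open>X\<^sub>i\<close> which, for \<open>U\<close>-most
  indices \<open>i\<close>, satisfy the norm bound up to \<open>1/(n+1)\<close> (compactness of the ball of \<open>\<ell>\<^sub>\<infinity>\<^sup>k\<close>) and
  map \<open>y\<^sub>0, \<dots>, y\<^sub>n\<close> within \<open>1/(n+1)\<close> of chosen representatives of \<open>t y\<^sub>0, \<dots>, t y\<^sub>n\<close>. Since \<open>U\<close>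
  is countably incomplete, one can choose \<open>n(i)\<close> tending to infinity along \<open>U\<close> such that all of
  this holds for \<open>\<tau>\<^sub>n\<^sub>(\<^sub>i\<^sub>)\<^sub>,\<^sub>i\<close>; the map induced by this single family is the extension.\<close>

section \<open>Normed spaces\<close>

lemma scalar_ring_simps [simp]:
  "carrier scalar_ring = UNIV"
  "a \<otimes>\<^bsub>scalar_ring\<^esub> b = a * b" "\<one>\<^bsub>scalar_ring\<^esub> = 1"
  "a \<oplus>\<^bsub>scalar_ring\<^esub> b = a + b" "\<zero>\<^bsub>scalar_ring\<^esub> = 0"
  by (simp_all add: scalar_ring_def)

context normed_space
begin

lemma smult_in [simp, intro]: "x \<in> carrier V \<Longrightarrow> c \<odot> x \<in> carrier V"
  by simp

lemma smult_add_left: "x \<in> carrier V \<Longrightarrow> (a + b) \<odot> x = a \<odot> x \<oplus> b \<odot> x"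
  using smult_l_distr[of a b x] by simp

lemma smult_add_right:
  "x \<in> carrier V \<Longrightarrow> y \<in> carrier V \<Longrightarrow> c \<odot> (x \<oplus> y) = c \<odot> x \<oplus> c \<odot> y"
  using smult_r_distr[of c x y] by simp

lemma smult_smult: "x \<in> carrier V \<Longrightarrow> a \<odot> (b \<odot> x) = (a * b) \<odot> x"
  using smult_assoc1[of a b x] by simp

lemma smult_1 [simp]: "x \<in> carrier V \<Longrightarrow> 1 \<odot> x = x"
  using smult_one[of x] by simp

lemma smult_0_left [simp]: "x \<in> carrier V \<Longrightarrow> 0 \<odot> x = \<zero>"
  using smult_l_null[of x] by simp

lemma smult_0_right [simp]: "c \<odot> \<zero> = \<zero>"
  using smult_r_null[of c] by simp

lemma a_inv_eq_smult: "x \<in> carrier V \<Longrightarrow> \<ominus> x = (- 1) \<odot> x"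
  by (intro add.inv_equality) (simp_all add: smult_add_left[symmetric] flip: smult_add_left[of x "-1" 1, simplified])

lemma minus_eq_smult: "y \<in> carrier V \<Longrightarrow> x \<ominus> y = x \<oplus> (- 1) \<odot> y"
  by (simp add: a_minus_def a_inv_eq_smult)

lemma vnorm_zero [simp]: "vnorm V \<zero> = 0"
  using vnorm_eq_0_iff[of \<zero>] by simp

lemma vnorm_a_inv [simp]: "x \<in> carrier V \<Longrightarrow> vnorm V (\<ominus> x) = vnorm V x"
  by (simp add: a_inv_eq_smult vnorm_smult)

lemma vnorm_nonneg [simp]: "x \<in> carrier V \<Longrightarrow> 0 \<le> vnorm V x"
  using vnorm_triangle[of x "\<ominus> x"] by (simp add: r_neg)

lemma vnorm_minus_triangle:
  "x \<in> carrier V \<Longrightarrow> y \<in> carrier V \<Longrightarrow> vnorm V (x \<ominus> y) \<le> vnorm V x + vnorm V y"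
  using vnorm_triangle[of x "\<ominus> y"] by (simp add: a_minus_def)

lemma add_minus_cancel [simp]: "x \<in> carrier V \<Longrightarrow> y \<in> carrier V \<Longrightarrow> y \<oplus> (x \<ominus> y) = x"
  by (simp add: a_minus_def a_lcomm[of y x] r_neg)

lemma vnorm_le_add_minus:
  "x \<in> carrier V \<Longrightarrow> y \<in> carrier V \<Longrightarrow> vnorm V x \<le> vnorm V y + vnorm V (x \<ominus> y)"
  using vnorm_triangle[of y "x \<ominus> y"] by simp

lemma vnorm_minus_commute:
  "x \<in> carrier V \<Longrightarrow> y \<in> carrier V \<Longrightarrow> vnorm V (x \<ominus> y) = vnorm V (y \<ominus> x)"
  using vnorm_a_inv[of "x \<ominus> y"] by (simp add: a_minus_def minus_add a_comm)

lemma smult_minus_right: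
  "x \<in> carrier V \<Longrightarrow> y \<in> carrier V \<Longrightarrow> c \<odot> (x \<ominus> y) = c \<odot> x \<ominus> c \<odot> y"
  by (simp add: minus_eq_smult smult_add_right smult_smult)

lemma smult_minus_left: "x \<in> carrier V \<Longrightarrow> (a - b) \<odot> x = a \<odot> x \<ominus> b \<odot> x"
  using smult_add_left[of x a "- b"] by (simp add: minus_eq_smult smult_smult)

lemma add_minus_add:
  "\<lbrakk>x \<in> carrier V; y \<in> carrier V; x' \<in> carrier V; y' \<in> carrier V\<rbrakk>
    \<Longrightarrow> (x \<oplus> y) \<ominus> (x' \<oplus> y') = (x \<ominus> x') \<oplus> (y \<ominus> y')"
  by (simp add: a_minus_def minus_add a_ac)

lemma minus_minus_minus:
  "\<lbrakk>x \<in> carrier V; y \<in> carrier V; z \<in> carrier V\<rbrakk> \<Longrightarrow> (x \<ominus> z) \<ominus> (y \<ominus> z) = x \<ominus> y"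
  using add_minus_add[of x "\<ominus> z" y "\<ominus> z"] by (simp add: a_minus_def r_neg l_neg)

lemma minus_eq_0_iff: "\<lbrakk>x \<in> carrier V; y \<in> carrier V\<rbrakk> \<Longrightarrow> x \<ominus> y = \<zero> \<longleftrightarrow> x = y"
  using add_minus_cancel[of x y] by (auto simp: a_minus_def r_neg)

text \<open>Negation is scaling by -1, so the closure under additive inverses demanded by
  \<open>submoduleI\<close> follows from closure under scalars.\<close>

lemma submodule_iff:
  "submodule L scalar_ring V \<longleftrightarrow> L \<subseteq> carrier V \<and> \<zero> \<in> L
     \<and> (\<forall>x\<in>L. \<forall>y\<in>L. x \<oplus> y \<in> L) \<and> (\<forall>c. \<forall>x\<in>L. c \<odot> x \<in> L)"
proof
  assume L: "submodule L scalar_ring V"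
  then interpret submodule L scalar_ring V .
  from one_closed have "\<zero> \<in> L" by simp
  with submoduleE[OF L] show "L \<subseteq> carrier V \<and> \<zero> \<in> L
     \<and> (\<forall>x\<in>L. \<forall>y\<in>L. x \<oplus> y \<in> L) \<and> (\<forall>c. \<forall>x\<in>L. c \<odot> x \<in> L)" by auto
next
  assume "L \<subseteq> carrier V \<and> \<zero> \<in> L
     \<and> (\<forall>x\<in>L. \<forall>y\<in>L. x \<oplus> y \<in> L) \<and> (\<forall>c. \<forall>x\<in>L. c \<odot> x \<in> L)"
  then show "submodule L scalar_ring V"
    by (intro submoduleI) (auto simp: a_inv_eq_smult subset_iff)
qed

section \<open>The topology of the norm metric\<close>

lemma Metric_space_vdist: "Metric_space (carrier V) (vdist V)"
proof
  fix x y z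
  show "0 \<le> vdist V x y" by (simp add: vdist_def)
  show "vdist V x y = vdist V y x" by (simp add: vdist_def vnorm_minus_commute)
  assume [simp]: "x \<in> carrier V" "y \<in> carrier V"
  show "vdist V x y = 0 \<longleftrightarrow> x = y" by (simp add: vdist_def vnorm_eq_0_iff minus_eq_0_iff)
  assume [simp]: "z \<in> carrier V"
  have "x \<ominus> z = (x \<ominus> y) \<oplus> (y \<ominus> z)"
    by (simp add: a_minus_def a_ac r_neg1 r_neg2)
  then show "vdist V x z \<le> vdist V x y + vdist V y z"
    by (simp add: vdist_def vnorm_triangle)
qed

lemma topspace_vtopology [simp]: "topspace (vtopology V) = carrier V"
  using Metric_space.topspace_mtopology[OF Metric_space_vdist] by (simp add: vtopology_def)

lemma closure_of_vtopology:
  assumes "S \<subseteq> carrier V"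
  shows "vtopology V closure_of S = {x \<in> carrier V. \<forall>e>0. \<exists>y\<in>S. vnorm V (x \<ominus> y) < e}"
  unfolding vtopology_def Metric_space.metric_closure_of[OF Metric_space_vdist]
    Metric_space.mball_def[OF Metric_space_vdist]
  using assms by (force simp: vdist_def subset_iff)

lemma closedin_vtopology:
  "closedin (vtopology V) M \<longleftrightarrow>
     M \<subseteq> carrier V \<and> (\<forall>x\<in>carrier V. (\<forall>e>0. \<exists>y\<in>M. vnorm V (x \<ominus> y) < e) \<longrightarrow> x \<in> M)"
proof -
  have "closedin (vtopology V) M \<longleftrightarrow> M \<subseteq> carrier V \<and> vtopology V closure_of M \<subseteq> M"
    by (metis closedin_subset closure_of_eq closure_of_subset_eq topspace_vtopology)
  then show ?thesis
    using closure_of_vtopology[of M] by auto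
qed

text \<open>The diagonal argument runs through a dense sequence rather than a countable dense set;
  repetitions in it are harmless.\<close>

lemma separable_subspaceE:
  assumes "closed_subspace Y V" "separable_space (subtopology (vtopology V) Y)"
  obtains y :: "nat \<Rightarrow> _" where "\<And>n. y n \<in> Y"
    "\<And>z e. z \<in> Y \<Longrightarrow> 0 < e \<Longrightarrow> \<exists>n. vnorm V (z \<ominus> y n) < e"
proof -
  have Y: "Y \<subseteq> carrier V" "\<zero> \<in> Y"
    using assms(1) by (auto simp: closed_subspace_def submodule_iff)
  from assms(2) Y obtain D where D: "countable D" "D \<subseteq> Y"
    and cl: "subtopology (vtopology V) Y closure_of D = Y"
    by (auto simp: separable_space_def topspace_subtopology Int_absorb1)
  have "Y \<subseteq> vtopology V closure_of D"
    using cl D by (metis closure_of_subtopology_subset)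
  then have dense: "\<exists>d\<in>D. vnorm V (z \<ominus> d) < e" if "z \<in> Y" "0 < e" for z e
    using closure_of_vtopology[of D] D Y that by blast
  \<comment> \<open>The zero vector of \<open>Y\<close> has to be approximated by \<open>D\<close>.
    Nonemptiness is what makes \<open>from_nat_into\<close> take its values in
    \<open>D\<close>.\<close>
  then have "D \<noteq> {}" using Y(2) zero_less_one by blast
  show thesis
  proof (rule that[of "from_nat_into D"])
    show "from_nat_into D n \<in> Y" for n
      using from_nat_into[OF \<open>D \<noteq> {}\<close>] D by blast
    show "\<exists>n. vnorm V (z \<ominus> from_nat_into D n) < e" if "z \<in> Y" "0 < e" for z e
      using dense[OF that] D(1) by (metis from_nat_into_surj)
  qed
qed

end

section \<open>The Hahn-Banach theorem\<close>

text \<open>Zorn's lemma for graphs of dominated functionals. The scalars may be complex, so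
  linearity is over \<open>of_real\<close> only. The bound is one-sided; at the negative of a vector
  it gives the other side.\<close>

lemma (in normed_space) real_Hahn_Banach:
  fixes u :: "'v \<Rightarrow> real"
  assumes M: "M \<subseteq> carrier V" "\<zero> \<in> M" "\<And>x y. x \<in> M \<Longrightarrow> y \<in> M \<Longrightarrow> x \<oplus> y \<in> M"
      "\<And>c x. x \<in> M \<Longrightarrow> of_real c \<odot> x \<in> M"
    and u: "\<And>x y. x \<in> M \<Longrightarrow> y \<in> M \<Longrightarrow> u (x \<oplus> y) = u x + u y"
      "\<And>c x. x \<in> M \<Longrightarrow> u (of_real c \<odot> x) = c * u x"
      "\<And>x. x \<in> M \<Longrightarrow> u x \<le> C * vnorm V x"
    and C: "0 \<le> C"
  obtains w where "\<And>x y. x \<in> carrier V \<Longrightarrow> y \<in> carrier V \<Longrightarrow> w (x \<oplus> y) = w x + w y"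
    "\<And>c x. x \<in> carrier V \<Longrightarrow> w (of_real c \<odot> x) = c * w x"
    "\<And>x. x \<in> carrier V \<Longrightarrow> w x \<le> C * vnorm V x"
    "\<And>x. x \<in> M \<Longrightarrow> w x = u x"
proof -
  \<comment> \<open>With sets of pairs, the upper bound of a chain is its union. Single-valuedness
    is not demanded of the members because the norm bound forces it, see
    \<open>uniq\<close>.\<close>
  define \<G> where "\<G> = {G. G \<subseteq> carrier V \<times> UNIV \<and> (\<lambda>x. (x, u x)) ` M \<subseteq> G
    \<and> (\<forall>x a y b. (x, a) \<in> G \<longrightarrow> (y, b) \<in> G \<longrightarrow> (x \<oplus> y, a + b) \<in> G)
    \<and> (\<forall>c x a. (x, a) \<in> G \<longrightarrow> (of_real c \<odot> x, c * a) \<in> G)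
    \<and> (\<forall>x a. (x, a) \<in> G \<longrightarrow> a \<le> C * vnorm V x)}"
  have "(\<lambda>x. (x, u x)) ` M \<in> \<G>"
    using M u by (auto simp: \<G>_def)
  moreover have "\<Union>\<C> \<in> \<G>" if "\<C> \<noteq> {}" "subset.chain \<G> \<C>" for \<C>
  proof -
    have "\<C> \<subseteq> \<G>" using that(2) by (simp add: subset.chain_def)
    have add: "(x \<oplus> y, a + b) \<in> \<Union>\<C>" if xy: "(x, a) \<in> \<Union>\<C>" "(y, b) \<in> \<Union>\<C>" for x a y b
    proof -
      obtain G H where "G \<in> \<C>" "H \<in> \<C>" "(x, a) \<in> G" "(y, b) \<in> H" using xy by blast
      moreover from this have "G \<subseteq> H \<or> H \<subseteq> G"
        using \<open>subset.chain \<G> \<C>\<close> by (auto simp: subset_chain_def)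
      ultimately obtain K where "K \<in> \<C>" "(x, a) \<in> K" "(y, b) \<in> K" by blast
      moreover have "K \<in> \<G>" using \<open>K \<in> \<C>\<close> \<open>\<C> \<subseteq> \<G>\<close> by blast
      ultimately have "(x \<oplus> y, a + b) \<in> K" by (simp add: \<G>_def)
      with \<open>K \<in> \<C>\<close> show ?thesis by blast
    qed
    have mem: "G \<subseteq> carrier V \<times> UNIV" "(\<lambda>x. (x, u x)) ` M \<subseteq> G"
      "(x, a) \<in> G \<longrightarrow> (of_real c \<odot> x, c * a) \<in> G" "(x, a) \<in> G \<longrightarrow> a \<le> C * vnorm V x"
      if "G \<in> \<C>" for G c x a
      using subsetD[OF \<open>\<C> \<subseteq> \<G>\<close> that] by (simp_all add: \<G>_def)
    show ?thesis
      unfolding \<G>_def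
    proof (intro CollectI conjI allI impI)
      show "\<Union>\<C> \<subseteq> carrier V \<times> UNIV" using mem(1) by blast
      show "(\<lambda>x. (x, u x)) ` M \<subseteq> \<Union>\<C>" using mem(2) \<open>\<C> \<noteq> {}\<close> by blast
      show "(of_real c \<odot> x, c * a) \<in> \<Union>\<C>" if "(x, a) \<in> \<Union>\<C>" for c x a
        using that mem(3) by blast
      show "a \<le> C * vnorm V x" if "(x, a) \<in> \<Union>\<C>" for x a
        using that mem(4) by blast
    qed (rule add)
  qed
  ultimately obtain G where "G \<in> \<G>" and max: "\<And>H. H \<in> \<G> \<Longrightarrow> G \<subseteq> H \<Longrightarrow> H = G"
    using subset_Zorn_nonempty[of \<G>] by blast
  then have Gc: "\<And>x a. (x, a) \<in> G \<Longrightarrow> x \<in> carrier V" and GM: "\<And>x. x \<in> M \<Longrightarrow> (x, u x) \<in> G"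
    and Gadd: "\<And>x a y b. (x, a) \<in> G \<Longrightarrow> (y, b) \<in> G \<Longrightarrow> (x \<oplus> y, a + b) \<in> G"
    and Gsm: "\<And>c x a. (x, a) \<in> G \<Longrightarrow> (of_real c \<odot> x, c * a) \<in> G"
    and Gle: "\<And>x a. (x, a) \<in> G \<Longrightarrow> a \<le> C * vnorm V x"
    by (auto simp: \<G>_def)
  have "u \<zero> = 0" using u(2)[OF M(2), of 0] by simp
  then have G0: "(\<zero>, 0) \<in> G" using GM[OF M(2)] by simp
  \<comment> \<open>The difference of two values at one point is a value at zero, where the bound
    makes it non-positive; by symmetry the values agree.\<close>
  have uniq: "a = b" if "(x, a) \<in> G" "(x, b) \<in> G" for x a b
  proof -
    have "a - b \<le> 0" if "(x, a) \<in> G" "(x, b) \<in> G" for a b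
      using Gle[OF Gadd[OF that(1) Gsm[OF that(2), of "-1"]]] Gc[OF that(1)]
      by (simp flip: minus_eq_smult) (simp add: a_minus_def r_neg)
    then show ?thesis using that by (metis diff_le_0_iff_le order.antisym)
  qed
  \<comment> \<open>Adjoining a value at \<open>x0\<close> to \<open>G\<close> stays within \<G>, so
    by maximality \<open>x0\<close> already belongs to the domain.\<close>
  have total: "\<exists>a. (x0, a) \<in> G" if x0: "x0 \<in> carrier V" for x0
  proof -
    \<comment> \<open>Each lower bound on a value at \<open>x0\<close> lies below each upper bound,
      by the triangle inequality for y + z = (y - x0) + (z + x0).\<close>
    have ab: "a - C * vnorm V (y \<ominus> x0) \<le> C * vnorm V (z \<oplus> x0) - b"
      if "(y, a) \<in> G" "(z, b) \<in> G" for y a z b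
    proof -
      have [simp]: "y \<in> carrier V" "z \<in> carrier V" using that Gc by auto
      have "(y \<ominus> x0) \<oplus> (z \<oplus> x0) = (y \<oplus> z) \<oplus> (x0 \<oplus> \<ominus> x0)"
        using x0 by (simp only: a_minus_def a_ac a_inv_closed add.m_closed \<open>y \<in> carrier V\<close> \<open>z \<in> carrier V\<close>)
      then have "y \<oplus> z = (y \<ominus> x0) \<oplus> (z \<oplus> x0)"
        using x0 by (simp add: r_neg)
      then have "vnorm V (y \<oplus> z) \<le> vnorm V (y \<ominus> x0) + vnorm V (z \<oplus> x0)"
        using x0 by (simp add: vnorm_triangle)
      from mult_left_mono[OF this C] Gle[OF Gadd[OF that]] show ?thesis
        by (simp add: algebra_simps)
    qed
    define A where "A = (\<lambda>(y, a). a - C * vnorm V (y \<ominus> x0)) ` G"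
    \<comment> \<open>Any number between the two families of bounds would be a valid value at
      \<open>x0\<close>; the supremum of the lower ones is one.\<close>
    define c where "c = Sup A"
    have "A \<noteq> {}" using G0 by (auto simp: A_def)
    have "bdd_above A"
      using ab[OF _ G0] unfolding A_def by (intro bdd_aboveI) auto
    have c1: "a - C * vnorm V (y \<ominus> x0) \<le> c" if "(y, a) \<in> G" for y a
      unfolding c_def using that by (intro cSup_upper \<open>bdd_above A\<close>) (auto simp: A_def)
    have c2: "c \<le> C * vnorm V (z \<oplus> x0) - b" if "(z, b) \<in> G" for z b
      unfolding c_def using that ab by (intro cSup_least \<open>A \<noteq> {}\<close>) (auto simp: A_def)
    define H where "H = {(y \<oplus> of_real s \<odot> x0, a + s * c) | y a s. (y, a) \<in> G}"
    have HI: "(y \<oplus> of_real s \<odot> x0, a + s * c) \<in> H" if "(y, a) \<in> G" for y a s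
      using that by (auto simp: H_def)
    have "G \<subseteq> H"
    proof
      fix p assume "p \<in> G"
      then show "p \<in> H"
        using HI[of "fst p" "snd p" 0] Gc[of "fst p" "snd p"] x0 by simp
    qed
    \<comment> \<open>Dividing by the modulus of \<open>s\<close> reduces s > 0 to the upper bound
      \<open>c2\<close> and s < 0 to the lower bound \<open>c1\<close>.\<close>
    have le: "a + s * c \<le> C * vnorm V (y \<oplus> of_real s \<odot> x0)" if "(y, a) \<in> G" for y a s
    proof -
      have y [simp]: "y \<in> carrier V" using that Gc by auto
      note x0 [simp]
      consider "s = 0" | "s > 0" | "s < 0" by linarith
      then show ?thesis
      proof cases
        case 1
        with Gle[OF that] show ?thesis by simp
      next
        case 2
        have "y \<oplus> of_real s \<odot> x0 = of_real s \<odot> (of_real (1 / s) \<odot> y \<oplus> x0)"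
          using 2 by (simp add: smult_add_right smult_smult)
        then have eq: "vnorm V (y \<oplus> of_real s \<odot> x0) = s * vnorm V (of_real (1 / s) \<odot> y \<oplus> x0)"
          using 2 by (simp add: vnorm_smult)
        have "s * c \<le> s * (C * vnorm V (of_real (1 / s) \<odot> y \<oplus> x0) - 1 / s * a)"
          using 2 by (intro mult_left_mono c2 Gsm that) auto
        also have "\<dots> = C * vnorm V (y \<oplus> of_real s \<odot> x0) - a"
          unfolding eq using 2 by (simp add: right_diff_distrib)
        finally show ?thesis by simp
      next
        case 3
        have "y \<oplus> of_real s \<odot> x0 = of_real (- s) \<odot> (of_real (1 / - s) \<odot> y \<ominus> x0)"
          using 3 by (simp add: minus_eq_smult smult_add_right smult_smult)
        then have eq: "vnorm V (y \<oplus> of_real s \<odot> x0) = (- s) * vnorm V (of_real (1 / - s) \<odot> y \<ominus> x0)"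
          using 3 by (simp only: vnorm_smult) (simp add: vnorm_smult)
        have "(- s) * (1 / (- s) * a - C * vnorm V (of_real (1 / - s) \<odot> y \<ominus> x0)) \<le> (- s) * c"
          using 3 by (intro mult_left_mono c1 Gsm that) auto
        moreover have "(- s) * (1 / (- s) * a - C * vnorm V (of_real (1 / - s) \<odot> y \<ominus> x0))
            = a - C * vnorm V (y \<oplus> of_real s \<odot> x0)"
          unfolding eq using 3 by (simp add: right_diff_distrib)
        ultimately show ?thesis by simp
      qed
    qed
    have "H \<in> \<G>"
      unfolding \<G>_def
    proof (intro CollectI conjI allI impI)
      show "H \<subseteq> carrier V \<times> UNIV" using Gc x0 by (auto simp: H_def)
      show "(\<lambda>x. (x, u x)) ` M \<subseteq> H" using GM \<open>G \<subseteq> H\<close> by auto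
      show "a \<le> C * vnorm V x" if "(x, a) \<in> H" for x a
        using that le by (auto simp: H_def)
      fix x a assume "(x, a) \<in> H"
      then obtain x' a' s where x: "x = x' \<oplus> of_real s \<odot> x0" "a = a' + s * c" "(x', a') \<in> G"
        by (auto simp: H_def)
      have [simp]: "x' \<in> carrier V" using x Gc by blast
      show "(of_real d \<odot> x, d * a) \<in> H" for d
        using HI[OF Gsm[OF x(3), of d], of "d * s"] x0
        by (simp add: x smult_add_right smult_smult algebra_simps)
      fix y b assume "(y, b) \<in> H"
      then obtain y' b' s' where y: "y = y' \<oplus> of_real s' \<odot> x0" "b = b' + s' * c" "(y', b') \<in> G"
        by (auto simp: H_def)
      have [simp]: "y' \<in> carrier V" using y Gc by blast
      show "(x \<oplus> y, a + b) \<in> H"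
        using HI[OF Gadd[OF x(3) y(3)], of "s + s'"] x0
        by (simp add: x y smult_add_left algebra_simps a_ac)
    qed
    with max \<open>G \<subseteq> H\<close> have "H = G" by blast
    moreover have "(x0, c) \<in> H" using HI[OF G0, of 1] x0 by simp
    ultimately show ?thesis by blast
  qed
  define w where "w x = (THE a. (x, a) \<in> G)" for x
  have wI: "w x = a" if "(x, a) \<in> G" for x a
    unfolding w_def using that uniq by blast
  have w: "(x, w x) \<in> G" if "x \<in> carrier V" for x
    using total[OF that] wI by blast
  show thesis
  proof (rule that[of w])
    show "w (x \<oplus> y) = w x + w y" if "x \<in> carrier V" "y \<in> carrier V" for x y
      using that by (intro wI Gadd w)
    show "w (of_real c \<odot> x) = c * w x" if "x \<in> carrier V" for c x
      using that by (intro wI Gsm w)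
    show "w x \<le> C * vnorm V x" if "x \<in> carrier V" for x
      using that by (intro Gle w)
    show "w x = u x" if "x \<in> M" for x
      using that by (intro wI GM)
  qed
qed

section \<open>The scalar field inside the complex numbers\<close>

locale scalar_embedding =
  fixes f :: "'k::real_normed_field \<Rightarrow> complex"
  assumes one [simp]: "f 1 = 1"
    and add: "f (x + y) = f x + f y"
    and mult: "f (x * y) = f x * f y"
    and norm [simp]: "cmod (f x) = norm x"
    and range: "range f = \<real> \<or> range f = UNIV"
begin

lemma zero [simp]: "f 0 = 0"
  using norm[of 0] by (simp del: norm)

lemma minus [simp]: "f (- x) = - f x"
  using add[of x "- x"] by (simp add: add_eq_0_iff)

lemma diff: "f (x - y) = f x - f y"
  using add[of x "- y"] by simp

lemma inj: "f x = f y \<longleftrightarrow> x = y"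
  using norm[of "x - y"] by (auto simp: diff simp del: norm)

text \<open>The distances to \<open>0\<close> and \<open>1\<close> determine a complex number up to conjugation, hence a real one.\<close>

lemma of_real [simp]: "f (of_real r) = of_real r"
proof -
  let ?z = "f (of_real r)"
  have "cmod ?z = \<bar>r\<bar>" by simp
  moreover have "cmod (?z - 1) = \<bar>r - 1\<bar>"
    using norm[of "of_real r - 1"] norm_of_real[of "r - 1", where 'a = 'k] by (simp add: diff del: norm)
  ultimately have "(Re ?z)\<^sup>2 + (Im ?z)\<^sup>2 = r\<^sup>2" "(Re ?z - 1)\<^sup>2 + (Im ?z)\<^sup>2 = (r - 1)\<^sup>2"
    by (metis cmod_power2 power2_abs, metis cmod_power2 power2_abs minus_complex.simps one_complex.simps diff_zero)
  then have "Re ?z = r" by (simp add: power2_eq_square algebra_simps)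
  with \<open>(Re ?z)\<^sup>2 + (Im ?z)\<^sup>2 = r\<^sup>2\<close> show ?thesis
    by (simp add: complex_eq_iff)
qed

end

text \<open>The type class only asserts that an embedding exists; this lets a proof fix one and
  interpret the locale with it.\<close>

lemma scalar_embeddingE:
  obtains f :: "'k::real_or_complex \<Rightarrow> complex" where "scalar_embedding f"
  using embeds_in_complex unfolding scalar_embedding_def by metis

text \<open>The real part of the functional is extended by the real theorem. A linear functional is
  determined by its real part, which yields \<open>h\<close> over either field, and multiplying the
  argument by a unimodular scalar turns the bound on the real part into one on the modulus.\<close>

theorem Hahn_Banach:
  fixes V :: "('k::real_or_complex, 'v) nspace" (structure) and g :: "'v \<Rightarrow> 'k"
  assumes "normed_space V" and "submodule M scalar_ring V" and C: "0 \<le> C"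
    and g: "\<And>x y. x \<in> M \<Longrightarrow> y \<in> M \<Longrightarrow> g (x \<oplus> y) = g x + g y"
      "\<And>c x. x \<in> M \<Longrightarrow> g (c \<odot> x) = c * g x"
      "\<And>x. x \<in> M \<Longrightarrow> norm (g x) \<le> C * vnorm V x"
  obtains h where "\<And>x y. x \<in> carrier V \<Longrightarrow> y \<in> carrier V \<Longrightarrow> h (x \<oplus> y) = h x + h y"
    "\<And>c x. x \<in> carrier V \<Longrightarrow> h (c \<odot> x) = c * h x"
    "\<And>x. x \<in> carrier V \<Longrightarrow> norm (h x) \<le> C * vnorm V x"
    "\<And>x. x \<in> M \<Longrightarrow> h x = g x"
proof -
  interpret normed_space V by fact
  obtain f :: "'k \<Rightarrow> complex" where "scalar_embedding f" by (rule scalar_embeddingE)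
  then interpret f: scalar_embedding f .
  have M: "M \<subseteq> carrier V" "\<zero> \<in> M" "\<And>x y. x \<in> M \<Longrightarrow> y \<in> M \<Longrightarrow> x \<oplus> y \<in> M"
    "\<And>c x. x \<in> M \<Longrightarrow> c \<odot> x \<in> M"
    using assms(2) by (auto simp: submodule_iff)
  have le: "Re (f a) \<le> norm a" for a
    using complex_Re_le_cmod[of "f a"] by simp
  obtain w where w: "\<And>x y. x \<in> carrier V \<Longrightarrow> y \<in> carrier V \<Longrightarrow> w (x \<oplus> y) = w x + w y"
    "\<And>c x. x \<in> carrier V \<Longrightarrow> w (of_real c \<odot> x) = c * w x"
    "\<And>x. x \<in> carrier V \<Longrightarrow> w x \<le> C * vnorm V x"
    "\<And>x. x \<in> M \<Longrightarrow> w x = Re (f (g x))"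
    by (rule real_Hahn_Banach[of M "\<lambda>x. Re (f (g x))" C])
      (use M C in \<open>auto simp: g f.add f.mult intro: order.trans[OF le]\<close>)
  have "\<exists>h. (\<forall>x\<in>carrier V. \<forall>y\<in>carrier V. h (x \<oplus> y) = h x + h y)
    \<and> (\<forall>c. \<forall>x\<in>carrier V. h (c \<odot> x) = c * h x)
    \<and> (\<forall>x\<in>carrier V. Re (f (h x)) = w x) \<and> (\<forall>x\<in>M. h x = g x)"
    using f.range
  proof
    assume R: "range f = \<real>"
    \<comment> \<open>All scalars are real here, so nothing was lost by taking real parts and
      \<open>w\<close> itself is the extension.\<close>
    have "Im (f a) = 0" for a
      using R by (metis complex_is_Real_iff rangeI)
    then have re: "of_real (Re (f a)) = a" for a
      by (simp add: f.inj[symmetric] complex_eq_iff)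
    have "w (c \<odot> x) = Re (f c) * w x" if "x \<in> carrier V" for c x
      using w(2)[OF that, of "Re (f c)"] by (simp add: re)
    then show ?thesis
      using w M(1) by (intro exI[of _ "\<lambda>x. of_real (w x)"]) (auto simp: re)
  next
    assume "range f = UNIV"
    \<comment> \<open>\<open>j\<close> is the imaginary unit of the abstract scalar field.\<close>
    then obtain j where j: "f j = \<i>" by (metis surj_def)
    have jj: "j * j = - 1" by (simp add: f.inj[symmetric] f.mult j)
    have dec: "a = of_real (Re (f a)) + j * of_real (Im (f a))" for a
      by (simp add: f.inj[symmetric] f.mult f.add j complex_eq_iff)
    \<comment> \<open>For a linear functional with real part \<open>w\<close>, the imaginary part at
      x must be - w (j x).\<close>
    define h where "h x = of_real (w x) - j * of_real (w (j \<odot> x))" for x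
    have add: "h (x \<oplus> y) = h x + h y" if "x \<in> carrier V" "y \<in> carrier V" for x y
      using that by (simp add: h_def w smult_add_right algebra_simps)
    have real: "h (of_real c \<odot> x) = of_real c * h x" if "x \<in> carrier V" for c x
    proof -
      have "j \<odot> (of_real c \<odot> x) = of_real c \<odot> (j \<odot> x)"
        using that by (simp add: smult_smult mult.commute)
      then show ?thesis using that by (simp add: h_def w algebra_simps)
    qed
    have jmul: "h (j \<odot> x) = j * h x" if "x \<in> carrier V" for x
    proof -
      have "j \<odot> (j \<odot> x) = of_real (- 1) \<odot> x" using that by (simp add: smult_smult jj)
      then have "h (j \<odot> x) = of_real (w (j \<odot> x)) + j * of_real (w x)"
        using w(2)[OF that, of "- 1"] that by (simp add: h_def)
      also have "\<dots> = j * of_real (w x) - (j * j) * of_real (w (j \<odot> x))" by (simp add: jj)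
      finally show ?thesis by (simp add: h_def algebra_simps)
    qed
    have "h (c \<odot> x) = c * h x" if "x \<in> carrier V" for c x
    proof -
      have "c \<odot> x = of_real (Re (f c)) \<odot> x \<oplus> j \<odot> (of_real (Im (f c)) \<odot> x)"
        using that dec[of c] by (simp add: smult_smult flip: smult_add_left)
      then have "h (c \<odot> x) = (of_real (Re (f c)) + j * of_real (Im (f c))) * h x"
        using that by (simp add: add real jmul algebra_simps)
      then show ?thesis using dec[of c] by simp
    qed
    moreover have "h x = g x" if "x \<in> M" for x
    proof -
      have "Re (f (g (j \<odot> x))) = - Im (f (g x))"
        using that by (simp add: g f.mult j)
      then show ?thesis
        using dec[of "g x"] that M(4)[OF that] by (simp add: h_def w)
    qed
    ultimately show ?thesis
      using add w by (intro exI[of _ h]) (auto simp: h_def f.diff f.mult j)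
  qed
  then obtain h where h: "\<And>x y. x \<in> carrier V \<Longrightarrow> y \<in> carrier V \<Longrightarrow> h (x \<oplus> y) = h x + h y"
    "\<And>c x. x \<in> carrier V \<Longrightarrow> h (c \<odot> x) = c * h x"
    "\<And>x. x \<in> carrier V \<Longrightarrow> Re (f (h x)) = w x" "\<And>x. x \<in> M \<Longrightarrow> h x = g x"
    by blast
  have hle: "norm (h x) \<le> C * vnorm V x" if "x \<in> carrier V" for x
  proof (cases "h x = 0")
    case True
    with C that show ?thesis by simp
  next
    case False
    \<comment> \<open>The unimodular \<open>c\<close> rotates \<open>h x\<close> to its modulus.
      This is real, so it equals \<open>w\<close> at the rotated vector and obeys the bound on
      \<open>w\<close>.\<close>
    define c where "c = of_real (norm (h x)) / h x"
    have "h (c \<odot> x) = of_real (norm (h x))" "norm c = 1"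
      using False that by (simp_all add: h c_def norm_divide)
    with h(3)[of "c \<odot> x"] w(3)[of "c \<odot> x"] that show ?thesis
      by (simp add: vnorm_smult)
  qed
  show thesis by (rule that[OF h(1,2) hle h(4)])
qed

section \<open>Finite-dimensional subspaces\<close>

context normed_space
begin

lemma submodule_carrier: "submodule (carrier V) scalar_ring V"
  by (simp add: submodule_iff)

lemma submodule_vspan:
  assumes "B \<subseteq> carrier V"
  shows "submodule (vspan V B) scalar_ring V"
proof -
  have "vspan V B \<subseteq> carrier V"
    using assms submodule_carrier by (auto simp: vspan_def)
  then show ?thesis
    by (auto simp: vspan_def submodule_iff)
qed

lemma subset_vspan: "B \<subseteq> vspan V B"
  by (auto simp: vspan_def)

lemma vspan_minimal: "submodule L scalar_ring V \<Longrightarrow> B \<subseteq> L \<Longrightarrow> vspan V B \<subseteq> L"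
  by (auto simp: vspan_def)

lemma vspan_insert:
  assumes B: "B \<subseteq> carrier V" and b: "b \<in> carrier V"
  shows "vspan V (insert b B) = {m \<oplus> c \<odot> b | m c. m \<in> vspan V B}" (is "_ = ?N")
proof
  have M: "vspan V B \<subseteq> carrier V" "\<zero> \<in> vspan V B"
    "\<And>x y. x \<in> vspan V B \<Longrightarrow> y \<in> vspan V B \<Longrightarrow> x \<oplus> y \<in> vspan V B"
    "\<And>c x. x \<in> vspan V B \<Longrightarrow> c \<odot> x \<in> vspan V B"
    using submodule_vspan[OF B] by (auto simp: submodule_iff)
  have NI: "m \<oplus> c \<odot> b \<in> ?N" if "m \<in> vspan V B" for m c using that by blast
  show "vspan V (insert b B) \<subseteq> ?N"
  proof (rule vspan_minimal)
    show "submodule ?N scalar_ring V"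
      unfolding submodule_iff
    proof (intro conjI ballI allI)
      show "?N \<subseteq> carrier V" using M(1) b by auto
      show "\<zero> \<in> ?N" using NI[OF M(2), of 0] b by simp
      fix x assume "x \<in> ?N"
      then obtain m c where x: "x = m \<oplus> c \<odot> b" "m \<in> vspan V B" by blast
      have m: "m \<in> carrier V" using x M(1) by blast
      show "d \<odot> x \<in> ?N" for d
        using NI[OF M(4)[OF x(2), of d], of "d * c"] b m
        by (simp add: x smult_add_right smult_smult)
      fix y assume "y \<in> ?N"
      then obtain m' c' where y: "y = m' \<oplus> c' \<odot> b" "m' \<in> vspan V B" by blast
      have m': "m' \<in> carrier V" using y M(1) by blast
      show "x \<oplus> y \<in> ?N"
        using NI[OF M(3)[OF x(2) y(2)], of "c + c'"] b m m'
        by (simp add: x y smult_add_left a_ac)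
    qed
    have "m \<in> ?N" if "m \<in> vspan V B" for m
      using NI[OF that, of 0] b subsetD[OF M(1) that] by simp
    then show "insert b B \<subseteq> ?N"
      using NI[OF M(2), of 1] b subset_vspan[of B] by auto
  qed
  have "submodule (vspan V (insert b B)) scalar_ring V"
    using B b by (intro submodule_vspan) auto
  moreover have "vspan V B \<subseteq> vspan V (insert b B)" "b \<in> vspan V (insert b B)"
    by (auto simp: vspan_def)
  ultimately show "?N \<subseteq> vspan V (insert b B)"
    by (auto simp: submodule_iff)
qed

text \<open>\<open>finite_dimensional\<close> asks for a basis. A finite generating set of least
  cardinality is one, since a redundant element could be removed.\<close>

lemma finite_dimensionalI:
  assumes "finite B" "B \<subseteq> carrier V" "vspan V B = carrier V"
  shows "finite_dimensional V"
proof -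
  let ?P = "\<lambda>B. finite B \<and> B \<subseteq> carrier V \<and> vspan V B = carrier V"
  obtain B where B: "?P B" and min: "\<And>C. ?P C \<Longrightarrow> card B \<le> card C"
    using ex_has_least_nat[of ?P B card] assms by blast
  have "b \<notin> vspan V (B - {b})" if "b \<in> B" for b
  proof
    assume b: "b \<in> vspan V (B - {b})"
    have sub: "B - {b} \<subseteq> carrier V" using B by blast
    have "B \<subseteq> vspan V (B - {b})" using b subset_vspan[of "B - {b}"] by blast
    then have "vspan V B \<subseteq> vspan V (B - {b})"
      by (intro vspan_minimal submodule_vspan sub)
    moreover have "vspan V (B - {b}) \<subseteq> carrier V"
      using submodule_vspan[OF sub] by (simp add: submodule_iff)
    ultimately have "?P (B - {b})" using B by auto
    from min[OF this] that B show False
      by (metis card_Diff1_less not_less)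
  qed
  with B show ?thesis unfolding finite_dimensional_def vbasis_def by blast
qed

lemma normed_space_subspace:
  assumes "submodule M scalar_ring V"
  shows "normed_space (subspace_of V M)"
proof -
  have M: "M \<subseteq> carrier V" using assms by (simp add: submodule_iff)
  interpret N: module scalar_ring "subspace_of V M"
    by (rule submodule.submodule_is_module[OF assms]) (rule module_axioms)
  show ?thesis
    by unfold_locales (use M in \<open>auto simp: vnorm_eq_0_iff vnorm_triangle vnorm_smult subset_iff\<close>)
qed

text \<open>The basis must generate within the subspace record, not within \<open>V\<close>. Both
  spans agree because a submodule of the span is a submodule of \<open>V\<close>.\<close>

lemma finite_dimensional_vspan:
  assumes "finite B" "B \<subseteq> carrier V"
  shows "finite_dimensional (subspace_of V (vspan V B))"
proof -
  have S: "submodule (vspan V B) scalar_ring V" by (rule submodule_vspan[OF assms(2)])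
  interpret N: normed_space "subspace_of V (vspan V B)"
    by (rule normed_space_subspace[OF S])
  have "vspan V B \<subseteq> L" if "submodule L scalar_ring (subspace_of V (vspan V B))" "B \<subseteq> L" for L
    using that S by (intro vspan_minimal) (auto simp: submodule_iff N.submodule_iff)
  moreover have "submodule (vspan V B) scalar_ring (subspace_of V (vspan V B))"
    using N.submodule_carrier by simp
  ultimately have "vspan (subspace_of V (vspan V B)) B = vspan V B"
    using subset_vspan[of B] unfolding vspan_def[of "subspace_of V (vspan V B)"] by blast
  then show ?thesis
    using N.finite_dimensionalI[of B] assms subset_vspan[of B] by simp
qed

end

text \<open>If \<open>M\<close> is closed and \<open>b \<notin> M\<close>, the coordinate of \<open>b\<close> is a bounded functional on \<open>M + Kb\<close>,
  and subtracting this coordinate maps limits of \<open>M + Kb\<close> to limits of \<open>M\<close>.\<close>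

lemma closed_subspace_insert:
  fixes V :: "('k::real_or_complex, 'v) nspace" (structure)
  assumes "normed_space V" and B: "B \<subseteq> carrier V" "closed_subspace (vspan V B) V" and b: "b \<in> carrier V"
  shows "closed_subspace (vspan V (insert b B)) V"
proof -
  interpret normed_space V by fact
  define M where "M = vspan V B"
  define N where "N = vspan V (insert b B)"
  have M: "M \<subseteq> carrier V" "\<zero> \<in> M" "\<And>x y. x \<in> M \<Longrightarrow> y \<in> M \<Longrightarrow> x \<oplus> y \<in> M"
    "\<And>c x. x \<in> M \<Longrightarrow> c \<odot> x \<in> M"
    and closed: "\<And>x. x \<in> carrier V \<Longrightarrow> (\<And>e. e > 0 \<Longrightarrow> \<exists>y\<in>M. vnorm V (x \<ominus> y) < e) \<Longrightarrow> x \<in> M"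
    using B(2) by (auto simp: closed_subspace_def submodule_iff closedin_vtopology M_def)
  have subN: "submodule N scalar_ring V"
    unfolding N_def using B(1) b by (intro submodule_vspan) auto
  then have N: "N \<subseteq> carrier V" by (simp add: submodule_iff)
  have Neq: "N = {m \<oplus> c \<odot> b | m c. m \<in> M}"
    unfolding N_def M_def by (rule vspan_insert[OF B(1) b])
  show ?thesis
  proof (cases "b \<in> M")
    case True
    then have "N = M"
      unfolding N_def M_def
      by (intro equalityI vspan_minimal submodule_vspan B(1)) (use B(1) b in \<open>auto simp: vspan_def\<close>)
    then show ?thesis using B(2) by (simp add: N_def M_def)
  next
    case False
    \<comment> \<open>As \<open>M\<close> is closed and misses \<open>b\<close>, the distance from
      \<open>b\<close> to \<open>M\<close> has a positive lower bound \<open>d\<close>.\<close>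
    with closed[OF b] obtain d where d: "d > 0" "\<And>m. m \<in> M \<Longrightarrow> d \<le> vnorm V (b \<ominus> m)"
      by (meson not_less)
    \<comment> \<open>Factoring out a nonzero \<open>c\<close> leaves \<open>b\<close> minus an
      element of \<open>M\<close>. Hence the coordinate of \<open>b\<close> has norm at most 1/d as
      a functional on \<open>N\<close>.\<close>
    have bound: "norm c * d \<le> vnorm V (m \<oplus> c \<odot> b)" if "m \<in> M" for m c
    proof (cases "c = 0")
      case True
      then show ?thesis using that M(1) b by (auto intro!: vnorm_nonneg)
    next
      case False
      have [simp]: "m \<in> carrier V" using that M(1) by blast
      have "m \<oplus> c \<odot> b = c \<odot> (b \<ominus> (- (1 / c)) \<odot> m)"
        using False b by (simp add: minus_eq_smult smult_add_right smult_smult a_comm)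
      then have "vnorm V (m \<oplus> c \<odot> b) = norm c * vnorm V (b \<ominus> (- (1 / c)) \<odot> m)"
        using b by (simp add: vnorm_smult)
      then show ?thesis using d(2)[OF M(4)[OF that]] by (simp add: mult_left_mono)
    qed
    have uniq: "c = c'" if "m \<in> M" "m' \<in> M" "m \<oplus> c \<odot> b = m' \<oplus> c' \<odot> b" for m m' c c'
    proof -
      have [simp]: "m \<in> carrier V" "m' \<in> carrier V" using that M(1) by auto
      have "(m \<ominus> m') \<oplus> (c - c') \<odot> b = (m \<oplus> c \<odot> b) \<ominus> (m' \<oplus> c' \<odot> b)"
        using b by (simp add: add_minus_add smult_minus_left)
      also have "\<dots> = \<zero>" using that(3) b by (simp add: minus_eq_0_iff)
      finally have "(m \<oplus> (- 1) \<odot> m') \<oplus> (c - c') \<odot> b = \<zero>" by (simp add: minus_eq_smult)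
      with bound[OF M(3)[OF that(1) M(4)[OF that(2), of "- 1"]], of "c - c'"]
      have "norm (c - c') * d \<le> 0" by simp
      with d(1) show ?thesis by (simp add: mult_le_0_iff)
    qed
    define g where "g x = (THE c. \<exists>m\<in>M. x = m \<oplus> c \<odot> b)" for x
    have g: "g (m \<oplus> c \<odot> b) = c" if "m \<in> M" for m c
      unfolding g_def using that uniq by (intro the_equality) blast+
    have NE: "\<exists>m\<in>M. x = m \<oplus> g x \<odot> b" if "x \<in> N" for x
      using that g by (auto simp: Neq)
    \<comment> \<open>\<open>g\<close> is meaningful on \<open>N\<close> only. Its extension can be
      evaluated at a limit point \<open>z\<close> of \<open>N\<close> before \<open>z\<close> is
      known to lie in \<open>N\<close>.\<close>
    obtain h where h: "\<And>x y. x \<in> carrier V \<Longrightarrow> y \<in> carrier V \<Longrightarrow> h (x \<oplus> y) = h x + h y"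
      "\<And>c x. x \<in> carrier V \<Longrightarrow> h (c \<odot> x) = c * h x"
      "\<And>x. x \<in> carrier V \<Longrightarrow> norm (h x) \<le> (1 / d) * vnorm V x"
      "\<And>x. x \<in> N \<Longrightarrow> h x = g x"
    proof (rule Hahn_Banach[OF \<open>normed_space V\<close> subN, of "1 / d" g])
      show "0 \<le> 1 / d" using d by simp
      fix x assume "x \<in> N"
      then obtain m c where x: "x = m \<oplus> c \<odot> b" "m \<in> M" by (auto simp: Neq)
      have m: "m \<in> carrier V" using x M(1) by blast
      have "a \<odot> x = a \<odot> m \<oplus> (a * c) \<odot> b" for a
        using m b by (simp add: x smult_add_right smult_smult)
      then show "g (a \<odot> x) = a * g x" for a
        using g[OF M(4)[OF x(2)]] g[OF x(2)] by (simp add: x)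
      show "norm (g x) \<le> 1 / d * vnorm V x"
        using bound[OF x(2), of c] d g[OF x(2)] by (simp add: x field_simps)
      fix y assume "y \<in> N"
      then obtain m' c' where y: "y = m' \<oplus> c' \<odot> b" "m' \<in> M" by (auto simp: Neq)
      have m': "m' \<in> carrier V" using y M(1) by blast
      have "x \<oplus> y = (m \<oplus> m') \<oplus> (c + c') \<odot> b"
        using b m m' by (simp add: x y smult_add_left a_ac)
      then show "g (x \<oplus> y) = g x + g y"
        using g[OF M(3)[OF x(2) y(2)]] g x y by simp
    qed (rule that)
    have "z \<in> N" if z: "z \<in> carrier V" and cl: "\<And>e. e > 0 \<Longrightarrow> \<exists>y\<in>N. vnorm V (z \<ominus> y) < e" for z
    proof -
      have "z \<ominus> h z \<odot> b \<in> M"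
      proof (rule closed)
        show "z \<ominus> h z \<odot> b \<in> carrier V" using z b by simp
        fix e :: real assume "e > 0"
        \<comment> \<open>\<open>K\<close> bounds the norm of the map from x to x - h(x) b, which
          sends \<open>N\<close> into \<open>M\<close>; so approximating \<open>z\<close> within e /
          K suffices.\<close>
        define K where "K = 1 + vnorm V b / d"
        have "K > 0" using b d by (simp add: K_def add_pos_nonneg)
        with \<open>e > 0\<close> obtain y where y: "y \<in> N" "vnorm V (z \<ominus> y) < e / K"
          using cl[of "e / K"] by auto
        from y N have yc: "y \<in> carrier V" by blast
        obtain m where m: "m \<in> M" "y = m \<oplus> h y \<odot> b" using NE[OF y(1)] h(4)[OF y(1)] by metis
        have mc: "m \<in> carrier V" using m(1) M(1) by blast
        have hdiff: "h (z \<ominus> y) = h z - h y"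
          using z yc by (simp add: minus_eq_smult h)
        have "(z \<ominus> h z \<odot> b) \<ominus> m = (z \<ominus> y) \<ominus> h (z \<ominus> y) \<odot> b"
        proof -
          have "m = y \<ominus> h y \<odot> b"
            using m(2) mc b by (metis add_minus_cancel a_comm add.inv_solve_right' a_minus_def smult_in yc)
          then show ?thesis
            unfolding hdiff using z yc b
            by (simp add: smult_minus_left minus_eq_smult smult_add_right smult_smult a_ac)
        qed
        then have "vnorm V ((z \<ominus> h z \<odot> b) \<ominus> m) \<le> vnorm V (z \<ominus> y) + vnorm V (h (z \<ominus> y) \<odot> b)"
          using z yc b by (simp add: vnorm_minus_triangle)
        also have "\<dots> \<le> vnorm V (z \<ominus> y) + ((1 / d) * vnorm V (z \<ominus> y)) * vnorm V b"
          unfolding vnorm_smult[OF b] using z yc b by (intro add_left_mono mult_right_mono h(3)) auto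
        also have "\<dots> = vnorm V (z \<ominus> y) * K" by (simp add: K_def algebra_simps)
        also have "\<dots> < e" using y(2) \<open>K > 0\<close> by (simp add: field_simps)
        finally show "\<exists>y\<in>M. vnorm V ((z \<ominus> h z \<odot> b) \<ominus> y) < e" using m(1) by blast
      qed
      moreover have "z = (z \<ominus> h z \<odot> b) \<oplus> h z \<odot> b"
        using z b by (simp add: a_minus_def a_assoc l_neg)
      ultimately show ?thesis unfolding Neq by blast
    qed
    with N subN show ?thesis
      by (auto simp: closed_subspace_def closedin_vtopology N_def)
  qed
qed

text \<open>\<open>script_L_inf\<close> speaks about closed subspaces only; this makes it applicable
  to the span of finitely many vectors.\<close>

lemma closed_subspace_vspan:
  fixes V :: "('k::real_or_complex, 'v) nspace" (structure)
  assumes V: "normed_space V" and "finite B" "B \<subseteq> carrier V"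
  shows "closed_subspace (vspan V B) V"
  using assms(2,3)
proof (induction B)
  case empty
  interpret normed_space V by fact
  have zero: "submodule {\<zero>} scalar_ring V" by (simp add: submodule_iff)
  have "\<zero> \<in> vspan V {}"
    using submodule_vspan[of "{}"] by (simp add: submodule_iff)
  then have "vspan V {} = {\<zero>}"
    using vspan_minimal[OF zero, of "{}"] by auto
  moreover have "x = \<zero>" if "x \<in> carrier V" "\<forall>e>0. vnorm V (x \<ominus> \<zero>) < e" for x
  proof -
    have "\<not> 0 < vnorm V x" using that by (auto simp: minus_eq_smult)
    then have "vnorm V x = 0" using vnorm_nonneg[OF that(1)] by simp
    then show ?thesis using that(1) by (simp add: vnorm_eq_0_iff)
  qed
  ultimately show ?case
    using zero by (auto simp: closed_subspace_def closedin_vtopology)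
next
  case (insert b B)
  then show ?case by (intro closed_subspace_insert V) auto
qed

section \<open>Linear combinations, bounded families and quotients\<close>

text \<open>Embedded in the complex plane, the family stays in a compact disc for
  \<open>U\<close>-most indices and so has a cluster point along \<open>U\<close>. An ultrafilter
  converges to each of its cluster points.\<close>

lemma ultrafilter_bounded_limit:
  fixes a :: "'i \<Rightarrow> 'k::real_or_complex"
  assumes U: "ultrafilter_on I U" and a: "eventually (\<lambda>i. norm (a i) \<le> R) U"
  obtains l where "(a \<longlongrightarrow> l) U"
proof -
  obtain f :: "'k \<Rightarrow> complex" where "scalar_embedding f" by (rule scalar_embeddingE)
  then interpret f: scalar_embedding f .
  have "U \<noteq> bot" and ultra: "\<And>P. eventually P U \<or> eventually (\<lambda>i. \<not> P i) U"
    using U by (auto simp: ultrafilter_on_def)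
  let ?F = "filtermap (\<lambda>i. f (a i)) U"
  have "?F \<noteq> bot" "eventually (\<lambda>z. z \<in> cball 0 R) ?F"
    using \<open>U \<noteq> bot\<close> a by (auto simp: filtermap_bot_iff eventually_filtermap)
  then obtain z where z: "inf (nhds z) ?F \<noteq> bot"
    using compact_filter[of "cball (0::complex) R"] by auto
  have lim: "((\<lambda>i. f (a i)) \<longlongrightarrow> z) U"
  proof (rule topological_tendstoI)
    fix S assume S: "open S" "z \<in> S"
    show "eventually (\<lambda>i. f (a i) \<in> S) U"
    proof (rule ccontr)
      assume "\<not> ?thesis"
      then have "eventually (\<lambda>w. w \<notin> S) ?F"
        using ultra by (auto simp: eventually_filtermap)
      moreover have "eventually (\<lambda>w. w \<in> S) (nhds z)"
        using S by (rule eventually_nhds_in_open)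
      ultimately have "eventually (\<lambda>_. False) (inf (nhds z) ?F)"
        unfolding eventually_inf by blast
      with z show False by (simp add: trivial_limit_def)
    qed
  qed
  \<comment> \<open>Both the real line and the plane are closed, so the complex limit is the image
    of a scalar.\<close>
  have "closed (range f)"
    using f.range closed_complex_Reals by auto
  from Lim_in_closed_set[OF this _ \<open>U \<noteq> bot\<close> lim] obtain l where l: "z = f l" by auto
  have "norm (a i - l) = cmod (f (a i) - z)" for i
    by (simp add: l flip: f.diff)
  with lim have "((\<lambda>i. norm (a i - l)) \<longlongrightarrow> 0) U"
    by (simp add: tendsto_norm_zero_iff LIM_zero_iff)
  then have "(a \<longlongrightarrow> l) U"
    by (simp add: tendsto_norm_zero_iff LIM_zero_iff)
  then show thesis by (rule that)
qed

text \<open>Recursion gives unfolding equations free of carrier conditions, so that, for instance,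
  taking a coordinate in \<open>ell_inf\<close> commutes with \<open>lin_comb\<close> for arbitrary
  vectors.\<close>

primrec lin_comb :: "('k, 'v) nspace \<Rightarrow> (nat \<Rightarrow> 'k) \<Rightarrow> (nat \<Rightarrow> 'v) \<Rightarrow> nat \<Rightarrow> 'v" where
  "lin_comb V a e 0 = \<zero>\<^bsub>V\<^esub>"
| "lin_comb V a e (Suc k) = lin_comb V a e k \<oplus>\<^bsub>V\<^esub> a k \<odot>\<^bsub>V\<^esub> e k"

lemma lin_comb_cong:
  "(\<And>j. j < k \<Longrightarrow> a j = b j) \<Longrightarrow> (\<And>j. j < k \<Longrightarrow> e j = f j) \<Longrightarrow> lin_comb V a e k = lin_comb V b f k"
  by (induction k) auto

context normed_space
begin

lemma lin_comb_closed [simp, intro]: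
  "(\<And>j. j < k \<Longrightarrow> e j \<in> carrier V) \<Longrightarrow> lin_comb V a e k \<in> carrier V"
  by (induction k) auto

lemma lin_comb_add:
  "(\<And>j. j < k \<Longrightarrow> e j \<in> carrier V)
    \<Longrightarrow> lin_comb V (\<lambda>j. a j + b j) e k = lin_comb V a e k \<oplus> lin_comb V b e k"
  by (induction k) (auto simp: smult_add_left a_ac)

lemma lin_comb_smult:
  "(\<And>j. j < k \<Longrightarrow> e j \<in> carrier V) \<Longrightarrow> lin_comb V (\<lambda>j. c * a j) e k = c \<odot> lin_comb V a e k"
  by (induction k) (auto simp: smult_add_right smult_smult)

lemma vnorm_lin_comb_le:
  "(\<And>j. j < k \<Longrightarrow> e j \<in> carrier V)
    \<Longrightarrow> vnorm V (lin_comb V a e k) \<le> (\<Sum>j<k. norm (a j) * vnorm V (e j))"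
proof (induction k)
  case (Suc k)
  have "vnorm V (lin_comb V a e (Suc k)) \<le> vnorm V (lin_comb V a e k) + vnorm V (a k \<odot> e k)"
    using Suc.prems by (auto intro!: vnorm_triangle)
  with Suc show ?case by (simp add: vnorm_smult)
qed simp

text \<open>A bound over coefficients in the unit cube is scaled to the cube of size
  \<open>B\<close> by dividing by \<open>B\<close>; for \<open>B = 0\<close> all coefficients
  vanish. It is applied to the coefficients f j x, whose size is proportional to the norm of
  x.\<close>

lemma vnorm_lin_comb_scale:
  assumes e: "\<And>j. j < k \<Longrightarrow> e j \<in> carrier V"
    and le: "\<And>a. (\<And>j. j < k \<Longrightarrow> norm (a j) \<le> 1) \<Longrightarrow> vnorm V (lin_comb V a e k) \<le> s"
    and a: "\<And>j. j < k \<Longrightarrow> norm (a j) \<le> B" and "0 \<le> B"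
  shows "vnorm V (lin_comb V a e k) \<le> s * B"
proof (cases "B = 0")
  case True
  have "vnorm V (lin_comb V a e k) \<le> (\<Sum>j<k. norm (a j) * vnorm V (e j))"
    by (rule vnorm_lin_comb_le[OF e])
  also have "\<dots> = 0" using a True by (intro sum.neutral) auto
  finally show ?thesis using True by simp
next
  case False
  with \<open>0 \<le> B\<close> have "0 < B" by simp
  let ?b = "\<lambda>j. of_real (1 / B) * a j"
  have "norm (?b j) \<le> 1" if "j < k" for j
    using a[OF that] \<open>0 < B\<close> by (simp only: norm_mult norm_of_real) (simp add: field_simps)
  then have "vnorm V (lin_comb V ?b e k) \<le> s" by (rule le)
  then show ?thesis
    using \<open>0 < B\<close> e by (simp only: lin_comb_smult vnorm_smult lin_comb_closed norm_of_real)
      (simp add: field_simps)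
qed

end

lemma cring_scalar_ring: "cring (scalar_ring :: 'k::real_normed_field ring)"
proof (rule cringI)
  show "abelian_group (scalar_ring :: 'k ring)"
    by (rule abelian_groupI) (auto simp: algebra_simps intro: exI[of _ "- x" for x])
  show "comm_monoid (scalar_ring :: 'k ring)"
    by (rule comm_monoidI) (auto simp: algebra_simps)
qed (auto simp: algebra_simps)

section \<open>Spaces of bounded families\<close>

lemma ell_inf_simps [simp]:
  "\<zero>\<^bsub>ell_inf I X\<^esub> = (\<lambda>i\<in>I. \<zero>\<^bsub>X i\<^esub>)"
  "x \<oplus>\<^bsub>ell_inf I X\<^esub> y = (\<lambda>i\<in>I. x i \<oplus>\<^bsub>X i\<^esub> y i)"
  "c \<odot>\<^bsub>ell_inf I X\<^esub> x = (\<lambda>i\<in>I. c \<odot>\<^bsub>X i\<^esub> x i)"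
  by (simp_all add: ell_inf_def)

lemma vnorm_ell_inf_upper:
  "x \<in> carrier (ell_inf I X) \<Longrightarrow> i \<in> I \<Longrightarrow> vnorm (X i) (x i) \<le> vnorm (ell_inf I X) x"
  by (auto simp: ell_inf_def intro!: cSup_upper)

lemma vnorm_ell_inf_le:
  "0 \<le> K \<Longrightarrow> (\<And>i. i \<in> I \<Longrightarrow> vnorm (X i) (x i) \<le> K) \<Longrightarrow> vnorm (ell_inf I X) x \<le> K"
  by (auto simp: ell_inf_def intro!: cSup_least)

lemma ell_infI:
  "x \<in> extensional I \<Longrightarrow> (\<And>i. i \<in> I \<Longrightarrow> x i \<in> carrier (X i))
    \<Longrightarrow> (\<And>i. i \<in> I \<Longrightarrow> vnorm (X i) (x i) \<le> K) \<Longrightarrow> x \<in> carrier (ell_inf I X)"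
  by (auto simp: ell_inf_def PiE_def intro!: bdd_aboveI[where M = K])

lemma ell_inf_extensional: "x \<in> carrier (ell_inf I X) \<Longrightarrow> x \<in> extensional I"
  by (auto simp: ell_inf_def PiE_def)

lemma ell_inf_component: "x \<in> carrier (ell_inf I X) \<Longrightarrow> i \<in> I \<Longrightarrow> x i \<in> carrier (X i)"
  by (auto simp: ell_inf_def)

lemma vnorm_ell_inf_nonneg: "x \<in> carrier (ell_inf I X) \<Longrightarrow> 0 \<le> vnorm (ell_inf I X) x"
  by (auto simp: ell_inf_def intro!: cSup_upper)

text \<open>Each law holds in every coordinate, and extensionality outside \<open>I\<close> turns
  coordinatewise equality into equality. The operations must also be seen to preserve
  boundedness.\<close>

lemma normed_space_ell_inf:
  assumes X: "\<And>i. i \<in> I \<Longrightarrow> normed_space (X i)"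
  shows "normed_space (ell_inf I X)"
proof -
  let ?L = "ell_inf I X"
  have ab: "abelian_group (X i)" if "i \<in> I" for i
    using module.axioms(2)[OF normed_space.axioms(1)[OF X[OF that]]] .
  then have am: "abelian_monoid (X i)" if "i \<in> I" for i
    using that by (simp add: abelian_group_def)
  note comp = ell_inf_component[of _ I X] and upper = vnorm_ell_inf_upper[of _ I X]
  have add_le: "vnorm (X i) (x i \<oplus>\<^bsub>X i\<^esub> y i) \<le> vnorm ?L x + vnorm ?L y"
    if "x \<in> carrier ?L" "y \<in> carrier ?L" "i \<in> I" for x y i
    using normed_space.vnorm_triangle[OF X[OF that(3)] comp[OF that(1,3)] comp[OF that(2,3)]]
      upper[of x i] upper[of y i] that
    by simp
  have smult_eq: "vnorm (X i) (c \<odot>\<^bsub>X i\<^esub> x i) = norm c * vnorm (X i) (x i)"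
    if "x \<in> carrier ?L" "i \<in> I" for c x i
    using normed_space.vnorm_smult[OF X comp] that by simp
  have zero: "\<zero>\<^bsub>?L\<^esub> \<in> carrier ?L"
    using X ab by (intro ell_infI[where K = 0])
      (auto simp: normed_space.vnorm_zero intro: abelian_monoid.zero_closed am)
  have add: "x \<oplus>\<^bsub>?L\<^esub> y \<in> carrier ?L" if "x \<in> carrier ?L" "y \<in> carrier ?L" for x y
    using that comp add_le by (intro ell_infI) (auto intro: abelian_monoid.a_closed am)
  have smult: "c \<odot>\<^bsub>?L\<^esub> x \<in> carrier ?L" if "x \<in> carrier ?L" for c x
    using that comp upper X
    by (intro ell_infI[where K = "norm c * vnorm ?L x"])
      (auto simp: smult_eq mult_left_mono intro: normed_space.smult_in)
  have "abelian_group ?L"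
  proof (rule abelian_groupI)
    fix x assume x: "x \<in> carrier ?L"
    show "\<zero>\<^bsub>?L\<^esub> \<oplus>\<^bsub>?L\<^esub> x = x"
      using x comp[OF x] by (intro extensionalityI[of _ I] ell_inf_extensional)
        (auto simp: abelian_monoid.l_zero[OF am] restrict_def extensional_def ell_inf_def)
    have "x i \<oplus>\<^bsub>X i\<^esub> (- 1) \<odot>\<^bsub>X i\<^esub> x i = \<zero>\<^bsub>X i\<^esub>" if "i \<in> I" for i
      using comp[OF x that] normed_space.a_inv_eq_smult[OF X[OF that] comp[OF x that]]
        abelian_group.r_neg[OF ab[OF that] comp[OF x that]] by simp
    moreover have "((- 1) \<odot>\<^bsub>X i\<^esub> x i) \<oplus>\<^bsub>X i\<^esub> x i = x i \<oplus>\<^bsub>X i\<^esub> (- 1) \<odot>\<^bsub>X i\<^esub> x i" if "i \<in> I" for i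
      using comp[OF x that] normed_space.smult_in[OF X[OF that] comp[OF x that]]
      by (intro abelian_monoid.a_comm[OF am[OF that]]) auto
    ultimately have "((- 1) \<odot>\<^bsub>?L\<^esub> x) \<oplus>\<^bsub>?L\<^esub> x = \<zero>\<^bsub>?L\<^esub>"
      by (auto intro!: restrict_ext)
    then show "\<exists>y\<in>carrier ?L. y \<oplus>\<^bsub>?L\<^esub> x = \<zero>\<^bsub>?L\<^esub>" using smult[OF x] by blast
    fix y assume y: "y \<in> carrier ?L"
    show "x \<oplus>\<^bsub>?L\<^esub> y = y \<oplus>\<^bsub>?L\<^esub> x"
      using x y comp by (auto intro!: restrict_ext abelian_monoid.a_comm[OF am])
    fix z assume z: "z \<in> carrier ?L"
    show "(x \<oplus>\<^bsub>?L\<^esub> y) \<oplus>\<^bsub>?L\<^esub> z = x \<oplus>\<^bsub>?L\<^esub> (y \<oplus>\<^bsub>?L\<^esub> z)"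
      using x y z comp by (auto intro!: restrict_ext abelian_monoid.a_assoc[OF am])
  qed (use add zero in blast)+
  then have "module scalar_ring ?L"
  proof (rule moduleI[OF cring_scalar_ring])
    fix x assume x: "x \<in> carrier ?L"
    show "c \<odot>\<^bsub>?L\<^esub> x \<in> carrier ?L" for c by (rule smult[OF x])
    show "\<one>\<^bsub>scalar_ring\<^esub> \<odot>\<^bsub>?L\<^esub> x = x"
      using x comp[OF x] ell_inf_extensional[OF x]
      by (auto simp: normed_space.smult_1[OF X] intro!: extensionalityI[of _ I])
    show "(a \<oplus>\<^bsub>scalar_ring\<^esub> b) \<odot>\<^bsub>?L\<^esub> x = a \<odot>\<^bsub>?L\<^esub> x \<oplus>\<^bsub>?L\<^esub> b \<odot>\<^bsub>?L\<^esub> x" for a b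
      using comp[OF x] by (auto simp: normed_space.smult_add_left[OF X] intro!: restrict_ext)
    show "(a \<otimes>\<^bsub>scalar_ring\<^esub> b) \<odot>\<^bsub>?L\<^esub> x = a \<odot>\<^bsub>?L\<^esub> (b \<odot>\<^bsub>?L\<^esub> x)" for a b
      using comp[OF x] by (auto simp: normed_space.smult_smult[OF X] intro!: restrict_ext)
    fix y assume y: "y \<in> carrier ?L"
    show "c \<odot>\<^bsub>?L\<^esub> (x \<oplus>\<^bsub>?L\<^esub> y) = c \<odot>\<^bsub>?L\<^esub> x \<oplus>\<^bsub>?L\<^esub> c \<odot>\<^bsub>?L\<^esub> y" for c
      using comp[OF x] comp[OF y] by (auto simp: normed_space.smult_add_right[OF X] intro!: restrict_ext)
  qed
  moreover have "normed_space_axioms ?L"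
  proof
    fix x assume x: "x \<in> carrier ?L"
    show "vnorm ?L x = 0 \<longleftrightarrow> x = \<zero>\<^bsub>?L\<^esub>"
    proof
      assume "vnorm ?L x = 0"
      then have "vnorm (X i) (x i) = 0" if "i \<in> I" for i
        using upper[OF x that] normed_space.vnorm_nonneg[OF X[OF that] comp[OF x that]] by simp
      then show "x = \<zero>\<^bsub>?L\<^esub>"
        using ell_inf_extensional[OF x] normed_space.vnorm_eq_0_iff[OF X comp[OF x]]
        by (auto intro!: extensionalityI[of _ I])
    next
      assume "x = \<zero>\<^bsub>?L\<^esub>"
      then have "vnorm ?L x \<le> 0"
        using X by (intro vnorm_ell_inf_le) (auto simp: normed_space.vnorm_zero)
      then show "vnorm ?L x = 0" using vnorm_ell_inf_nonneg[OF x] by simp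
    qed
    show "vnorm ?L (c \<odot>\<^bsub>?L\<^esub> x) = norm c * vnorm ?L x" for c
    proof (rule order.antisym)
      show le: "vnorm ?L (c \<odot>\<^bsub>?L\<^esub> x) \<le> norm c * vnorm ?L x"
        using x upper[OF x] by (intro vnorm_ell_inf_le)
          (auto simp: smult_eq mult_left_mono vnorm_ell_inf_nonneg)
      \<comment> \<open>For nonzero \<open>c\<close>, each coordinate of \<open>x\<close> is bounded
        through the corresponding coordinate of the multiple, divided by
        \<open>norm c\<close>.\<close>
      show "norm c * vnorm ?L x \<le> vnorm ?L (c \<odot>\<^bsub>?L\<^esub> x)"
      proof (cases "c = 0")
        case True
        then show ?thesis using vnorm_ell_inf_nonneg[OF smult[OF x, of c]] by simp
      next
        case False
        have "vnorm ?L x \<le> vnorm ?L (c \<odot>\<^bsub>?L\<^esub> x) / norm c"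
        proof (rule vnorm_ell_inf_le)
          show "0 \<le> vnorm ?L (c \<odot>\<^bsub>?L\<^esub> x) / norm c"
            using vnorm_ell_inf_nonneg[OF smult[OF x, of c]] by simp
          show "vnorm (X i) (x i) \<le> vnorm ?L (c \<odot>\<^bsub>?L\<^esub> x) / norm c" if "i \<in> I" for i
            using upper[OF smult[OF x, of c] that] False smult_eq[OF x that, of c] that
            by (simp add: field_simps)
        qed
        with False show ?thesis by (simp add: field_simps)
      qed
    qed
    fix y assume y: "y \<in> carrier ?L"
    show "vnorm ?L (x \<oplus>\<^bsub>?L\<^esub> y) \<le> vnorm ?L x + vnorm ?L y"
      using x y add_le by (intro vnorm_ell_inf_le) (auto simp: vnorm_ell_inf_nonneg)
  qed
  ultimately show ?thesis by (rule normed_space.intro)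
qed

section \<open>Quotients by submodules\<close>

context normed_space
begin

lemma abelian_subgroup_submodule: "submodule M scalar_ring V \<Longrightarrow> abelian_subgroup M V"
  using submodule.axioms(1) by (intro abelian_subgroupI3 additive_subgroup.intro) (auto intro: abelian_group_axioms)

context
  fixes M
  assumes M: "submodule M scalar_ring V"
begin

interpretation abelian_subgroup M V
  by (rule abelian_subgroup_submodule[OF M])

lemma mem_coset_iff: "x \<in> carrier V \<Longrightarrow> z \<in> M +> x \<longleftrightarrow> z \<in> carrier V \<and> z \<ominus> x \<in> M"
  using a_rcos_module[of x z] a_elemrcos_carrier[of x z] by (auto simp: a_minus_def)

lemma coset_eq_iff:
  "x \<in> carrier V \<Longrightarrow> y \<in> carrier V \<Longrightarrow> M +> x = M +> y \<longleftrightarrow> x \<ominus> y \<in> M"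
  using mem_coset_iff[of y x] a_repr_independence'[of x y] a_rcos_self[of x] by metis

lemma carrier_quotient: "carrier (quotient_space V M) = (+>) M ` carrier V"
  by (auto simp: quotient_space_def A_RCOSETS_def')

lemma add_quotient:
  "x \<in> carrier V \<Longrightarrow> y \<in> carrier V
    \<Longrightarrow> (M +> x) \<oplus>\<^bsub>quotient_space V M\<^esub> (M +> y) = M +> (x \<oplus> y)"
  by (simp add: quotient_space_def a_rcos_sum)

lemma zero_quotient: "\<zero>\<^bsub>quotient_space V M\<^esub> = M +> \<zero>"
  using a_subset by (simp add: quotient_space_def)

text \<open>In the union that defines the scalar multiple of a coset, all members coincide:
  representatives differ by an element of \<open>M\<close>, and so do their multiples.\<close>

lemma smult_quotient:
  assumes x: "x \<in> carrier V"
  shows "c \<odot>\<^bsub>quotient_space V M\<^esub> (M +> x) = M +> (c \<odot> x)"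
proof -
  have "(\<Union>z\<in>M +> x. M +> (c \<odot> z)) = (\<Union>z\<in>M +> x. M +> (c \<odot> x))"
  proof (rule SUP_cong[OF refl])
    fix z assume "z \<in> M +> x"
    then have "z \<in> carrier V" "c \<odot> (z \<ominus> x) \<in> M"
      using M x by (auto simp: mem_coset_iff submodule_iff)
    then show "M +> (c \<odot> z) = M +> (c \<odot> x)" using x by (simp add: coset_eq_iff smult_minus_right)
  qed
  also have "\<dots> = M +> (c \<odot> x)" using a_rcos_self[OF x] by auto
  finally show ?thesis by (simp add: quotient_space_def)
qed

lemma vnorm_quotient_le:
  assumes "x \<in> carrier V" "z \<in> carrier V" "z \<ominus> x \<in> M"
  shows "vnorm (quotient_space V M) (M +> x) \<le> vnorm V z"
proof -
  have "bdd_below (vnorm V ` (M +> x))"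
    using assms(1) by (intro bdd_belowI[of _ 0]) (auto simp: mem_coset_iff)
  then show ?thesis
    using assms by (auto simp: quotient_space_def mem_coset_iff intro!: cINF_lower)
qed

lemma vnorm_quotient_approx:
  assumes "x \<in> carrier V" "0 < d"
  obtains z where "z \<in> carrier V" "z \<ominus> x \<in> M" "vnorm V z < vnorm (quotient_space V M) (M +> x) + d"
proof -
  have "bdd_below (vnorm V ` (M +> x))"
    using assms(1) by (intro bdd_belowI[of _ 0]) (auto simp: mem_coset_iff)
  moreover have "M +> x \<noteq> {}" using a_rcos_self[OF assms(1)] by blast
  ultimately have "\<exists>z\<in>M +> x. vnorm V z < vnorm (quotient_space V M) (M +> x) + d"
    using assms(2) cINF_less_iff[of "M +> x" "vnorm V" "(INF z\<in>M +> x. vnorm V z) + d"]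
    by (simp add: quotient_space_def)
  then show thesis using that assms(1) by (auto simp: mem_coset_iff)
qed

end

end

section \<open>Ultraproducts\<close>

lemma lin_comb_ell_inf: "i \<in> I \<Longrightarrow> lin_comb (ell_inf I X) a e k i = lin_comb (X i) a (\<lambda>j. e j i) k"
  by (induction k) auto

text \<open>That the quotient is normed is an assumption of the locale; in the final theorem it is
  part of the hypothesis \<open>script_L_inf_plus\<close>.\<close>

locale normed_ultraproduct =
  fixes I :: "'i set" and U :: "'i filter" and X :: "'i \<Rightarrow> ('k::real_or_complex, 'v) nspace"
  assumes ultra: "ultrafilter_on I U"
    and normed: "\<And>i. i \<in> I \<Longrightarrow> normed_space (X i)"
    and normed_ultraproduct: "normed_space (ultraproduct U I X)"
begin

abbreviation "L \<equiv> ell_inf I X"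
abbreviation "N \<equiv> c0_along U I X"
abbreviation "E \<equiv> ultraproduct U I X"
abbreviation "cls x \<equiv> N +>\<^bsub>L\<^esub> x"

sublocale L: normed_space L
  by (rule normed_space_ell_inf[OF normed])

sublocale E: normed_space E
  by (rule normed_ultraproduct)

lemma U_neq_bot: "U \<noteq> bot"
  using ultra by (simp add: ultrafilter_on_def)

lemma eventually_in_I: "eventually (\<lambda>i. i \<in> I) U"
  using ultra by (auto simp: ultrafilter_on_def le_principal)

lemma minus_ell_inf:
  "x \<in> carrier L \<Longrightarrow> y \<in> carrier L \<Longrightarrow> i \<in> I \<Longrightarrow> (x \<ominus>\<^bsub>L\<^esub> y) i = x i \<ominus>\<^bsub>X i\<^esub> y i"
  by (simp add: L.minus_eq_smult normed_space.minus_eq_smult[OF normed] ell_inf_component)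

lemma c0_iff:
  assumes x: "x \<in> carrier L"
  shows "x \<in> N \<longleftrightarrow> (\<forall>d>0. eventually (\<lambda>i. vnorm (X i) (x i) < d) U)"
proof -
  have nonneg: "eventually (\<lambda>i. 0 \<le> vnorm (X i) (x i)) U"
    using eventually_in_I
    by eventually_elim (rule normed_space.vnorm_nonneg[OF normed ell_inf_component[OF x]])
  have "((\<lambda>i. vnorm (X i) (x i)) \<longlongrightarrow> 0) U \<longleftrightarrow>
      (\<forall>d>0. eventually (\<lambda>i. vnorm (X i) (x i) < d) U)"
    unfolding tendsto_iff dist_real_def
    by (intro all_cong eventually_cong[OF nonneg]) simp
  with x show ?thesis by (simp add: c0_along_def)
qed

lemma submodule_c0: "submodule N scalar_ring L"
  unfolding L.submodule_iff
proof (intro conjI ballI allI)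
  show "N \<subseteq> carrier L" by (auto simp: c0_along_def)
  have "eventually (\<lambda>i. vnorm (X i) ((\<zero>\<^bsub>L\<^esub>) i) < d) U" if "d > 0" for d
    using eventually_in_I by eventually_elim (use that in \<open>auto simp: normed_space.vnorm_zero[OF normed]\<close>)
  then show "\<zero>\<^bsub>L\<^esub> \<in> N" using c0_iff[OF L.zero_closed] by blast
  fix x assume "x \<in> N"
  then have x: "x \<in> carrier L" "((\<lambda>i. vnorm (X i) (x i)) \<longlongrightarrow> 0) U" by (auto simp: c0_along_def)
  show "c \<odot>\<^bsub>L\<^esub> x \<in> N" for c
  proof -
    have "((\<lambda>i. norm c * vnorm (X i) (x i)) \<longlongrightarrow> 0) U"
      using x(2) by (rule tendsto_mult_right_zero)
    moreover have "eventually (\<lambda>i. norm c * vnorm (X i) (x i) = vnorm (X i) ((c \<odot>\<^bsub>L\<^esub> x) i)) U"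
      using eventually_in_I
      by eventually_elim (simp add: normed_space.vnorm_smult[OF normed] ell_inf_component[OF x(1)])
    ultimately have "((\<lambda>i. vnorm (X i) ((c \<odot>\<^bsub>L\<^esub> x) i)) \<longlongrightarrow> 0) U"
      by (rule Lim_transform_eventually)
    then show ?thesis using L.smult_in[OF x(1)] by (simp add: c0_along_def del: ell_inf_simps)
  qed
  fix y assume "y \<in> N"
  then have y: "y \<in> carrier L" "((\<lambda>i. vnorm (X i) (y i)) \<longlongrightarrow> 0) U" by (auto simp: c0_along_def)
  have xy: "x \<oplus>\<^bsub>L\<^esub> y \<in> carrier L" using x y by (intro L.a_closed)
  have lim: "((\<lambda>i. vnorm (X i) (x i) + vnorm (X i) (y i)) \<longlongrightarrow> 0) U"
    using tendsto_add[OF x(2) y(2)] by simp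
  have bound: "eventually (\<lambda>i. norm (vnorm (X i) ((x \<oplus>\<^bsub>L\<^esub> y) i)) \<le> vnorm (X i) (x i) + vnorm (X i) (y i)) U"
    using eventually_in_I
  proof eventually_elim
    case (elim i)
    interpret Xi: normed_space "X i" by (rule normed[OF elim])
    show ?case using elim ell_inf_component[OF x(1) elim] ell_inf_component[OF y(1) elim]
      by (simp add: Xi.vnorm_triangle)
  qed
  from Lim_null_comparison[OF this lim] xy show "x \<oplus>\<^bsub>L\<^esub> y \<in> N" by (simp add: c0_along_def del: ell_inf_simps)
qed

section \<open>Classes of bounded families and their norms\<close>

lemma carrier_E: "carrier E = (\<lambda>x. cls x) ` carrier L"
  unfolding ultraproduct_def by (rule L.carrier_quotient[OF submodule_c0])

lemma cls_in [simp, intro]: "x \<in> carrier L \<Longrightarrow> cls x \<in> carrier E"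
  by (auto simp: carrier_E)

lemma cls_add: "x \<in> carrier L \<Longrightarrow> y \<in> carrier L \<Longrightarrow> cls (x \<oplus>\<^bsub>L\<^esub> y) = cls x \<oplus>\<^bsub>E\<^esub> cls y"
  unfolding ultraproduct_def by (rule L.add_quotient[OF submodule_c0, symmetric])

lemma cls_smult: "x \<in> carrier L \<Longrightarrow> cls (c \<odot>\<^bsub>L\<^esub> x) = c \<odot>\<^bsub>E\<^esub> cls x"
  unfolding ultraproduct_def by (rule L.smult_quotient[OF submodule_c0, symmetric])

lemma cls_zero: "cls (\<zero>\<^bsub>L\<^esub>) = \<zero>\<^bsub>E\<^esub>"
  unfolding ultraproduct_def by (rule L.zero_quotient[OF submodule_c0, symmetric])

lemma cls_eq_iff:
  assumes "x \<in> carrier L" "y \<in> carrier L"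
  shows "cls x = cls y \<longleftrightarrow> (\<forall>d>0. eventually (\<lambda>i. vnorm (X i) (x i \<ominus>\<^bsub>X i\<^esub> y i) < d) U)"
proof -
  have "cls x = cls y \<longleftrightarrow> (\<forall>d>0. eventually (\<lambda>i. vnorm (X i) ((x \<ominus>\<^bsub>L\<^esub> y) i) < d) U)"
    using assms by (simp only: L.coset_eq_iff[OF submodule_c0] c0_iff L.minus_closed)
  also have "\<dots> \<longleftrightarrow> (\<forall>d>0. eventually (\<lambda>i. vnorm (X i) (x i \<ominus>\<^bsub>X i\<^esub> y i) < d) U)"
    by (intro all_cong eventually_cong[OF eventually_in_I]) (simp add: minus_ell_inf assms)
  finally show ?thesis .
qed

text \<open>One half of the fact that the norm of a class is the limit along \<open>U\<close> of the
  coordinate norms: a bound on \<open>U\<close>-most coordinates suffices.\<close>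

lemma vnorm_cls_le:
  assumes x: "x \<in> carrier L" and "0 \<le> K" and K: "eventually (\<lambda>i. vnorm (X i) (x i) \<le> K) U"
  shows "vnorm E (cls x) \<le> K"
proof -
  \<comment> \<open>Replacing the offending coordinates by zero does not change the class and gives
    a representative bounded by \<open>K\<close> everywhere.\<close>
  define z where "z = (\<lambda>i\<in>I. if vnorm (X i) (x i) \<le> K then x i else \<zero>\<^bsub>X i\<^esub>)"
  have zI: "z i \<in> carrier (X i)" "vnorm (X i) (z i) \<le> K" if "i \<in> I" for i
  proof -
    interpret Xi: normed_space "X i" by (rule normed[OF that])
    show "z i \<in> carrier (X i)" "vnorm (X i) (z i) \<le> K"
      using ell_inf_component[OF x that] that \<open>0 \<le> K\<close> by (auto simp: z_def)
  qed
  then have z: "z \<in> carrier L"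
    by (intro ell_infI[of _ _ _ K]) (auto simp: z_def)
  have "eventually (\<lambda>i. vnorm (X i) (z i \<ominus>\<^bsub>X i\<^esub> x i) < d) U" if "d > 0" for d
    using eventually_in_I K
  proof eventually_elim
    case (elim i)
    interpret Xi: normed_space "X i" by (rule normed[OF elim(1)])
    show ?case using elim that ell_inf_component[OF x elim(1)]
      by (simp add: z_def a_minus_def Xi.r_neg)
  qed
  then have "cls z = cls x" using cls_eq_iff[OF z x] by blast
  moreover have "vnorm E (cls z) \<le> vnorm L z"
  proof -
    have "z \<ominus>\<^bsub>L\<^esub> z = \<zero>\<^bsub>L\<^esub>" using L.minus_eq_0_iff[OF z z] by blast
    then have "z \<ominus>\<^bsub>L\<^esub> z \<in> N" using submodule_c0 unfolding L.submodule_iff by metis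
    then show ?thesis
      unfolding ultraproduct_def by (rule L.vnorm_quotient_le[OF submodule_c0 z z])
  qed
  moreover have "vnorm L z \<le> K"
    using \<open>0 \<le> K\<close> zI by (intro vnorm_ell_inf_le)
  ultimately show ?thesis by simp
qed

text \<open>The other half: a representative whose sup norm nearly attains the quotient norm differs
  from \<open>x\<close> by less than d / 2 in \<open>U\<close>-most coordinates.\<close>

lemma eventually_vnorm_less:
  assumes x: "x \<in> carrier L" and "0 < d"
  shows "eventually (\<lambda>i. vnorm (X i) (x i) < vnorm E (cls x) + d) U"
proof -
  obtain z where z: "z \<in> carrier L" "z \<ominus>\<^bsub>L\<^esub> x \<in> N" "vnorm L z < vnorm E (cls x) + d / 2"
    using L.vnorm_quotient_approx[OF submodule_c0 x, of "d / 2"] \<open>0 < d\<close>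
    unfolding ultraproduct_def by auto
  have "cls z = cls x" using L.coset_eq_iff[OF submodule_c0 z(1) x] z(2) by blast
  then have "eventually (\<lambda>i. vnorm (X i) (x i \<ominus>\<^bsub>X i\<^esub> z i) < d / 2) U"
    using cls_eq_iff[OF x z(1)] half_gt_zero[OF \<open>0 < d\<close>] by metis
  with eventually_in_I show ?thesis
  proof eventually_elim
    case (elim i)
    interpret Xi: normed_space "X i" by (rule normed[OF elim(1)])
    show ?case
      using elim(2) z(3) vnorm_ell_inf_upper[OF z(1) elim(1)]
        Xi.vnorm_le_add_minus[OF ell_inf_component[OF x elim(1)] ell_inf_component[OF z(1) elim(1)]]
      by simp
  qed
qed

lemma lin_comb_cls:
  "(\<And>j. j < k \<Longrightarrow> e j \<in> carrier L) \<Longrightarrow> lin_comb E a (\<lambda>j. cls (e j)) k = cls (lin_comb L a e k)"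
proof (induction k)
  case 0
  show ?case by (simp only: lin_comb.simps cls_zero)
next
  case (Suc k)
  then show ?case
    by (simp only: lin_comb.simps)
      (simp add: cls_add cls_smult L.lin_comb_closed L.smult_in del: ell_inf_simps)
qed

text \<open>Otherwise pick, for \<open>U\<close>-most indices \<open>i\<close>, coefficients in the unit ball violating the bound.
  As the unit ball of \<open>\<ell>\<^sub>\<infinity>\<^sup>k\<close> is compact, they converge along \<open>U\<close>, and the limit violates
  the bound for \<open>E\<close>.\<close>

lemma eventually_uniform_bound:
  assumes e: "\<And>j. j < k \<Longrightarrow> e j \<in> carrier L"
    and s: "\<And>a. (\<And>j. j < k \<Longrightarrow> norm (a j) \<le> 1) \<Longrightarrow> vnorm E (lin_comb E a (\<lambda>j. cls (e j)) k) \<le> s"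
    and "s < s'"
  shows "eventually (\<lambda>i. \<forall>a. (\<forall>j<k. norm (a j) \<le> 1)
    \<longrightarrow> vnorm (X i) (lin_comb (X i) a (\<lambda>j. e j i) k) \<le> s') U" (is "eventually ?P U")
proof (rule ccontr)
  assume "\<not> ?thesis"
  then have "eventually (\<lambda>i. \<not> ?P i) U"
    using ultra unfolding ultrafilter_on_def by blast
  then have "eventually (\<lambda>i. \<exists>a. (\<forall>j<k. norm (a j) \<le> 1) \<and>
      s' < vnorm (X i) (lin_comb (X i) a (\<lambda>j. e j i) k)) U"
    by eventually_elim (auto simp: not_le)
  then obtain \<alpha> where \<alpha>: "eventually (\<lambda>i. (\<forall>j<k. norm (\<alpha> i j) \<le> 1) \<and>
      s' < vnorm (X i) (lin_comb (X i) (\<alpha> i) (\<lambda>j. e j i) k)) U"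
    unfolding eventually_ex by blast
  have "\<exists>l. ((\<lambda>i. \<alpha> i j) \<longlongrightarrow> l) U \<and> norm l \<le> 1" if "j < k" for j
  proof -
    have le: "eventually (\<lambda>i. norm (\<alpha> i j) \<le> 1) U"
      using \<alpha> by eventually_elim (use that in blast)
    obtain l where l: "((\<lambda>i. \<alpha> i j) \<longlongrightarrow> l) U"
      by (rule ultrafilter_bounded_limit[OF ultra le])
    with le show ?thesis
      using tendsto_upperbound[OF tendsto_norm[OF l] le U_neq_bot] by blast
  qed
  then obtain l where l: "\<And>j. j < k \<Longrightarrow> ((\<lambda>i. \<alpha> i j) \<longlongrightarrow> l j) U" "\<And>j. j < k \<Longrightarrow> norm (l j) \<le> 1"
    by metis
  \<comment> \<open>Half of the gap pays for replacing the coefficients at \<open>i\<close> by their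
    limits, the other half for passing from the class to its coordinate at \<open>i\<close>.\<close>
  let ?d = "(s' - s) / 2"
  have "((\<lambda>i. \<Sum>j<k. norm (\<alpha> i j - l j) * vnorm L (e j)) \<longlongrightarrow> (\<Sum>j<k. norm (l j - l j) * vnorm L (e j))) U"
    using l(1) by (intro tendsto_intros) auto
  then have "eventually (\<lambda>i. (\<Sum>j<k. norm (\<alpha> i j - l j) * vnorm L (e j)) < ?d) U"
    using \<open>s < s'\<close> by (intro order_tendstoD(2)) auto
  moreover have "eventually (\<lambda>i. vnorm (X i) (lin_comb L l e k i) < vnorm E (cls (lin_comb L l e k)) + ?d) U"
    using e \<open>s < s'\<close> by (intro eventually_vnorm_less) auto
  ultimately have "eventually (\<lambda>i. False) U"
    using \<alpha> eventually_in_I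
  proof eventually_elim
    case (elim i)
    interpret Xi: normed_space "X i" by (rule normed[OF elim(4)])
    let ?e = "\<lambda>j. e j i"
    have ei: "?e j \<in> carrier (X i)" if "j < k" for j
      using ell_inf_component[OF e[OF that] elim(4)] .
    have "vnorm (X i) (lin_comb (X i) (\<lambda>j. \<alpha> i j - l j) ?e k) \<le> (\<Sum>j<k. norm (\<alpha> i j - l j) * vnorm (X i) (?e j))"
      by (rule Xi.vnorm_lin_comb_le[OF ei])
    also have "\<dots> \<le> (\<Sum>j<k. norm (\<alpha> i j - l j) * vnorm L (e j))"
      using vnorm_ell_inf_upper[OF e elim(4)] by (intro sum_mono mult_left_mono) auto
    also have "\<dots> < ?d" by (rule elim(1))
    finally have 1: "vnorm (X i) (lin_comb (X i) (\<lambda>j. \<alpha> i j - l j) ?e k) < ?d" .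
    have 2: "vnorm (X i) (lin_comb (X i) l ?e k) < s + ?d"
      using elim(2,4) s[of l] l(2) lin_comb_cls[of k e l] e lin_comb_ell_inf[OF elim(4), of X l e k] by fastforce
    have 3: "lin_comb (X i) (\<alpha> i) ?e k
        = lin_comb (X i) l ?e k \<oplus>\<^bsub>X i\<^esub> lin_comb (X i) (\<lambda>j. \<alpha> i j - l j) ?e k"
      using Xi.lin_comb_add[of k ?e l "\<lambda>j. \<alpha> i j - l j"] ei by simp
    have "vnorm (X i) (lin_comb (X i) (\<alpha> i) ?e k)
        \<le> vnorm (X i) (lin_comb (X i) l ?e k) + vnorm (X i) (lin_comb (X i) (\<lambda>j. \<alpha> i j - l j) ?e k)"
      unfolding 3 by (intro Xi.vnorm_triangle Xi.lin_comb_closed ei)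
    with 1 2 conjunct2[OF elim(3)] show False by (simp add: field_simps)
  qed
  then show False using U_neq_bot by (simp add: trivial_limit_def)
qed

end

section \<open>Extension with finite-dimensional range\<close>

lemma vnorm_le_opnorm:
  assumes V: "normed_space V" and W: "normed_space W" and T: "operator V W T" and x: "x \<in> carrier V"
  shows "vnorm W (T x) \<le> opnorm V W T * vnorm V x"
proof -
  interpret V: normed_space V by fact
  interpret W: normed_space W by fact
  obtain K where K: "\<And>x. x \<in> carrier V \<Longrightarrow> vnorm W (T x) \<le> K * vnorm V x"
    using T unfolding operator_def by blast
  have Tc: "\<And>x. x \<in> carrier V \<Longrightarrow> T x \<in> carrier W"
    and Tsm: "\<And>c x. x \<in> carrier V \<Longrightarrow> T (c \<odot>\<^bsub>V\<^esub> x) = c \<odot>\<^bsub>W\<^esub> T x"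
    using T by (auto simp: operator_def)
  \<comment> \<open>A real supremum bounds its members only if the set is bounded above. The
    constant \<open>K\<close> may be negative, hence the absolute value.\<close>
  have "vnorm W (T x) \<le> \<bar>K\<bar>" if "x \<in> carrier V" "vnorm V x \<le> 1" for x
  proof -
    have "K * vnorm V x \<le> \<bar>K\<bar> * 1"
      using that V.vnorm_nonneg[OF that(1)] by (intro mult_mono) auto
    with K[OF that(1)] show ?thesis by simp
  qed
  then have bdd: "bdd_above ((\<lambda>x. vnorm W (T x)) ` {x \<in> carrier V. vnorm V x \<le> 1})"
    by (intro bdd_aboveI[of _ "\<bar>K\<bar>"]) auto
  show ?thesis
  proof (cases "vnorm V x = 0")
    case True
    with K[OF x] show ?thesis by simp
  next
    case False
    then have pos: "0 < vnorm V x" using V.vnorm_nonneg[OF x] by simp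
    let ?c = "of_real (1 / vnorm V x)"
    have "vnorm W (T (?c \<odot>\<^bsub>V\<^esub> x)) \<le> opnorm V W T"
      unfolding opnorm_def using x pos
      by (intro cSUP_upper bdd) (simp add: V.vnorm_smult norm_divide)
    then show ?thesis
      using pos x Tc by (simp add: Tsm W.vnorm_smult norm_divide field_simps)
  qed
qed

lemma opnorm_le:
  assumes V: "normed_space V" and "0 \<le> C"
    and le: "\<And>x. x \<in> carrier V \<Longrightarrow> vnorm W (T x) \<le> C * vnorm V x"
  shows "opnorm V W T \<le> C"
proof -
  interpret V: normed_space V by fact
  have "{x \<in> carrier V. vnorm V x \<le> 1} \<noteq> {}" by (auto intro!: exI[of _ "\<zero>\<^bsub>V\<^esub>"])
  moreover have "vnorm W (T x) \<le> C" if "x \<in> carrier V" "vnorm V x \<le> 1" for x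
    using le[OF that(1)] mult_left_mono[OF that(2) \<open>0 \<le> C\<close>] by simp
  ultimately show ?thesis unfolding opnorm_def by (intro cSUP_least) auto
qed

lemma operator_zero:
  assumes V: "normed_space V" and W: "normed_space W" and T: "operator V W T"
  shows "T \<zero>\<^bsub>V\<^esub> = \<zero>\<^bsub>W\<^esub>"
proof -
  interpret V: normed_space V by fact
  interpret W: normed_space W by fact
  have "T (0 \<odot>\<^bsub>V\<^esub> \<zero>\<^bsub>V\<^esub>) = 0 \<odot>\<^bsub>W\<^esub> T \<zero>\<^bsub>V\<^esub>" "T \<zero>\<^bsub>V\<^esub> \<in> carrier W"
    using T V.zero_closed unfolding operator_def by blast+
  then show ?thesis by simp
qed

text \<open>A vector of positive norm makes the factor in \<open>vnorm_le_opnorm\<close>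
  nonnegative. Otherwise the unit ball is just the origin and the supremum is 0.\<close>

lemma opnorm_nonneg:
  assumes V: "normed_space V" and W: "normed_space W" and T: "operator V W T"
  shows "0 \<le> opnorm V W T"
proof (cases "\<exists>x\<in>carrier V. vnorm V x \<noteq> 0")
  case True
  then obtain x where x: "x \<in> carrier V" "0 < vnorm V x"
    using normed_space.vnorm_nonneg[OF V] less_le by metis
  have "0 \<le> vnorm W (T x)"
    using T x by (intro normed_space.vnorm_nonneg[OF W]) (auto simp: operator_def)
  also have "\<dots> \<le> opnorm V W T * vnorm V x" by (rule vnorm_le_opnorm[OF V W T x(1)])
  finally show ?thesis using x(2) by (simp add: zero_le_mult_iff)
next
  case False
  interpret V: normed_space V by fact
  interpret W: normed_space W by fact
  have "{x \<in> carrier V. vnorm V x \<le> 1} = {\<zero>\<^bsub>V\<^esub>}"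
    using False V.vnorm_eq_0_iff by auto
  then show ?thesis using operator_zero[OF V W T] by (simp add: opnorm_def)
qed

lemma lin_comb_operator:
  assumes V: "normed_space V" and W: "normed_space W" and T: "operator V W T"
    and e: "\<And>j. j < k \<Longrightarrow> e j \<in> carrier V"
  shows "T (lin_comb V a e k) = lin_comb W a (\<lambda>j. T (e j)) k"
  using e
proof (induction k)
  case 0
  show ?case using operator_zero[OF V W T] by simp
next
  case (Suc k)
  interpret V: normed_space V by fact
  have "T (x \<oplus>\<^bsub>V\<^esub> y) = T x \<oplus>\<^bsub>W\<^esub> T y" if "x \<in> carrier V" "y \<in> carrier V" for x y
    using T that by (auto simp: operator_def)
  moreover have "T (c \<odot>\<^bsub>V\<^esub> x) = c \<odot>\<^bsub>W\<^esub> T x" if "x \<in> carrier V" for x c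
    using T that by (auto simp: operator_def)
  ultimately show ?case using Suc by (auto simp: V.lin_comb_closed)
qed

section \<open>Finite-dimensional sup-norm spaces\<close>

lemma normed_space_scalar: "normed_space (scalar_space :: ('k::real_normed_field, 'k) nspace)"
proof -
  have "abelian_group (scalar_space :: ('k, 'k) nspace)"
    by (rule abelian_groupI) (auto simp: scalar_space_def algebra_simps intro: exI[of _ "- x" for x])
  then have "module scalar_ring (scalar_space :: ('k, 'k) nspace)"
    by (rule moduleI[OF cring_scalar_ring]) (auto simp: scalar_space_def algebra_simps)
  then show ?thesis
    by (intro normed_space.intro normed_space_axioms.intro)
      (auto simp: scalar_space_def norm_triangle_ineq norm_mult)
qed

lemma normed_space_ell_inf_n: "normed_space (ell_inf_n k)"
  unfolding ell_inf_n_def by (rule normed_space_ell_inf) (rule normed_space_scalar)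

lemma lin_comb_scalar: "lin_comb scalar_space a e k = (\<Sum>j<k. a j * e j)"
  by (induction k) (auto simp: scalar_space_def)

definition unit_vector :: "nat \<Rightarrow> nat \<Rightarrow> nat \<Rightarrow> 'k::real_normed_field" where
  "unit_vector k j = (\<lambda>m\<in>{..<k}. if m = j then 1 else 0)"

lemma restrict_in_ell_inf_n: "restrict a {..<k} \<in> carrier (ell_inf_n k)"
  unfolding ell_inf_n_def
  by (rule ell_infI[where K = "\<Sum>j<k. norm (a j)"])
    (auto simp: scalar_space_def intro!: member_le_sum)

lemma lin_comb_unit_vector: "lin_comb (ell_inf_n k) a (unit_vector k) k = restrict a {..<k}"
proof -
  interpret normed_space "ell_inf_n k" by (rule normed_space_ell_inf_n)
  have "lin_comb (ell_inf_n k) a (unit_vector k) k \<in> carrier (ell_inf_n k)"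
    unfolding unit_vector_def by (intro lin_comb_closed restrict_in_ell_inf_n)
  then have "lin_comb (ell_inf_n k) a (unit_vector k) k \<in> extensional {..<k}"
    unfolding ell_inf_n_def by (rule ell_inf_extensional)
  moreover have "lin_comb (ell_inf_n k) a (unit_vector k) k i = a i" if "i < k" for i
  proof -
    have "lin_comb (ell_inf_n k) a (unit_vector k) k i = (\<Sum>j<k. a j * unit_vector k j i)"
      unfolding ell_inf_n_def using that by (simp add: lin_comb_ell_inf lin_comb_scalar)
    also have "\<dots> = (\<Sum>j<k. if i = j then a j else 0)"
      using that by (intro sum.cong) (auto simp: unit_vector_def)
    also have "\<dots> = a i" using that by simp
    finally show ?thesis .
  qed
  ultimately show ?thesis by (intro extensionalityI[of _ "{..<k}"]) auto
qed

lemma norm_component_le: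
  "x \<in> carrier (ell_inf_n k) \<Longrightarrow> j < k \<Longrightarrow> norm (x j) \<le> vnorm (ell_inf_n k) x"
  using vnorm_ell_inf_upper[of x "{..<k}" "\<lambda>_. scalar_space" j]
  by (simp add: ell_inf_n_def scalar_space_def)

text \<open>The hypothesis is used with \<mu> = r + d / 2. The other d / 2 makes the bound strict,
  so that actual isomorphisms can be picked although the infimum in \<open>bm_dist\<close> need not
  be attained.\<close>

lemma script_L_inf_plusE:
  fixes E :: "('k::real_or_complex, 'v) nspace"
  assumes "script_L_inf_plus r E" and B: "finite B" "B \<subseteq> carrier E" and "0 < d"
  obtains F k A S where "submodule F scalar_ring E" "B \<subseteq> F"
    "operator (subspace_of E F) (ell_inf_n k) A" "operator (ell_inf_n k) (subspace_of E F) S"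
    "\<And>x. x \<in> F \<Longrightarrow> S (A x) = x"
    "opnorm (subspace_of E F) (ell_inf_n k) A * opnorm (ell_inf_n k) (subspace_of E F) S < r + d"
proof -
  have L: "script_L_inf (r + d / 2) E"
    using assms(1) \<open>0 < d\<close> by (simp add: script_L_inf_plus_def)
  then have "normed_space E" by (simp add: script_L_inf_def banach_space_def)
  interpret normed_space E by fact
  have "closed_subspace (vspan E B) E" "finite_dimensional (subspace_of E (vspan E B))"
    using closed_subspace_vspan[OF \<open>normed_space E\<close> B] finite_dimensional_vspan[OF B] by auto
  with L obtain F where F: "closed_subspace F E" "vspan E B \<subseteq> F"
    and dist: "bm_dist (subspace_of E F) (ell_inf_n (vdim (subspace_of E F))) \<le> ereal (r + d / 2)"
    unfolding script_L_inf_def by blast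
  define k where "k = vdim (subspace_of E F)"
  have "bm_dist (subspace_of E F) (ell_inf_n k) < ereal (r + d)"
    using dist unfolding k_def[symmetric] by (rule le_less_trans) (simp add: \<open>0 < d\<close>)
  then obtain A S where "operator (subspace_of E F) (ell_inf_n k) A"
    "operator (ell_inf_n k) (subspace_of E F) S" "\<And>x. x \<in> F \<Longrightarrow> S (A x) = x"
    "opnorm (subspace_of E F) (ell_inf_n k) A * opnorm (ell_inf_n k) (subspace_of E F) S < r + d"
    unfolding bm_dist_def INF_less_iff by auto
  moreover have "submodule F scalar_ring E" "B \<subseteq> F"
    using F subset_vspan[of B] by (auto simp: closed_subspace_def)
  ultimately show thesis by (intro that)
qed

section \<open>One stage of the construction: finitely many points\<close>

context normed_ultraproduct
begin

text \<open>The maps are linear at every index of \<open>I\<close>, whereas the norm bound and the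
  approximation hold only along \<open>U\<close>. Allowing every representative \<open>z\<close> of
  \<open>t y\<close> lets later stages share one fixed choice.\<close>

lemma finite_approximation:
  fixes V :: "('k, 'x) nspace"
  assumes V: "normed_space V" and Y: "submodule Y scalar_ring V"
    and t: "operator (subspace_of V Y) E t" and LE: "script_L_inf_plus r E"
    and D: "finite D" "D \<subseteq> Y" and "0 < d"
  shows "\<exists>\<tau>. (\<forall>i\<in>I. (\<forall>x\<in>carrier V. \<tau> i x \<in> carrier (X i))
      \<and> (\<forall>x\<in>carrier V. \<forall>y\<in>carrier V. \<tau> i (x \<oplus>\<^bsub>V\<^esub> y) = \<tau> i x \<oplus>\<^bsub>X i\<^esub> \<tau> i y)
      \<and> (\<forall>c. \<forall>x\<in>carrier V. \<tau> i (c \<odot>\<^bsub>V\<^esub> x) = c \<odot>\<^bsub>X i\<^esub> \<tau> i x))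
    \<and> eventually (\<lambda>i. \<forall>x\<in>carrier V. vnorm (X i) (\<tau> i x) \<le> (r * opnorm (subspace_of V Y) E t + d) * vnorm V x) U
    \<and> (\<forall>y\<in>D. \<forall>z\<in>carrier L. cls z = t y
        \<longrightarrow> (\<forall>d>0. eventually (\<lambda>i. vnorm (X i) (\<tau> i y \<ominus>\<^bsub>X i\<^esub> z i) < d) U))"
proof -
  interpret V: normed_space V by fact
  have Yn: "normed_space (subspace_of V Y)" by (rule V.normed_space_subspace[OF Y])
  have Yc: "Y \<subseteq> carrier V" using Y by (simp add: V.submodule_iff)
  define c where "c = opnorm (subspace_of V Y) E t"
  have "0 \<le> c" unfolding c_def by (rule opnorm_nonneg[OF Yn normed_ultraproduct t])
  have t_in: "\<And>y. y \<in> Y \<Longrightarrow> t y \<in> carrier E"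
    and t_add: "\<And>x y. x \<in> Y \<Longrightarrow> y \<in> Y \<Longrightarrow> t (x \<oplus>\<^bsub>V\<^esub> y) = t x \<oplus>\<^bsub>E\<^esub> t y"
    and t_smult: "\<And>a x. x \<in> Y \<Longrightarrow> t (a \<odot>\<^bsub>V\<^esub> x) = a \<odot>\<^bsub>E\<^esub> t x"
    using t by (auto simp: operator_def)
  have t_le: "vnorm E (t y) \<le> c * vnorm V y" if "y \<in> Y" for y
    using vnorm_le_opnorm[OF Yn normed_ultraproduct t, of y] that by (simp add: c_def)
  \<comment> \<open>Multiplied by \<open>c\<close> this excess in the distance costs at most d / 2;
    the summand 1 covers c = 0.\<close>
  have "0 < d / (2 * (c + 1))" using \<open>0 < d\<close> \<open>0 \<le> c\<close> by simp
  obtain F k A S where F: "submodule F scalar_ring E" "t ` D \<subseteq> F"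
    and A: "operator (subspace_of E F) (ell_inf_n k) A"
    and S: "operator (ell_inf_n k) (subspace_of E F) S"
    and SA: "\<And>x. x \<in> F \<Longrightarrow> S (A x) = x"
    and less: "opnorm (subspace_of E F) (ell_inf_n k) A * opnorm (ell_inf_n k) (subspace_of E F) S
      < r + d / (2 * (c + 1))"
    by (rule script_L_inf_plusE[OF LE, of "t ` D" "d / (2 * (c + 1))"])
      (use D t_in \<open>0 < d / (2 * (c + 1))\<close> in auto)
  let ?K = "ell_inf_n k :: ('k, nat \<Rightarrow> 'k) nspace"
  interpret K: normed_space ?K by (rule normed_space_ell_inf_n)
  have Fn: "normed_space (subspace_of E F)" by (rule E.normed_space_subspace[OF F(1)])
  have Fc: "F \<subseteq> carrier E" and F_add: "\<And>x y. x \<in> F \<Longrightarrow> y \<in> F \<Longrightarrow> x \<oplus>\<^bsub>E\<^esub> y \<in> F"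
    and F_smult: "\<And>a x. x \<in> F \<Longrightarrow> a \<odot>\<^bsub>E\<^esub> x \<in> F" and F_zero: "\<zero>\<^bsub>E\<^esub> \<in> F"
    using F(1) by (auto simp: E.submodule_iff)
  define \<alpha> where "\<alpha> = opnorm (subspace_of E F) ?K A"
  define \<sigma> where "\<sigma> = opnorm ?K (subspace_of E F) S"
  have "0 \<le> \<alpha>" unfolding \<alpha>_def by (rule opnorm_nonneg[OF Fn normed_space_ell_inf_n A])
  have A_in: "\<And>x. x \<in> F \<Longrightarrow> A x \<in> carrier ?K"
    and A_add: "\<And>x y. x \<in> F \<Longrightarrow> y \<in> F \<Longrightarrow> A (x \<oplus>\<^bsub>E\<^esub> y) = A x \<oplus>\<^bsub>?K\<^esub> A y"
    and A_smult: "\<And>a x. x \<in> F \<Longrightarrow> A (a \<odot>\<^bsub>E\<^esub> x) = a \<odot>\<^bsub>?K\<^esub> A x"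
    using A by (auto simp: operator_def)
  have A_le: "vnorm ?K (A x) \<le> \<alpha> * vnorm E x" if "x \<in> F" for x
    using vnorm_le_opnorm[OF Fn normed_space_ell_inf_n A, of x] that by (simp add: \<alpha>_def)
  have S_in: "S x \<in> F" if "x \<in> carrier ?K" for x
    using S that by (auto simp: operator_def)
  have S_E: "operator ?K E S"
    using S Fc by (auto simp: operator_def)
  \<comment> \<open>The submodule on which \<open>A\<close> may be applied after \<open>t\<close>;
    it contains \<open>D\<close>.\<close>
  define Z where "Z = {y \<in> Y. t y \<in> F}"
  have t_zero: "t \<zero>\<^bsub>V\<^esub> = \<zero>\<^bsub>E\<^esub>"
    using operator_zero[OF Yn normed_ultraproduct t] by simp
  have Z: "submodule Z scalar_ring V"
    using Y F_add F_smult F_zero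
    by (auto simp: V.submodule_iff Z_def t_add t_smult t_zero)
  have component: "(x \<oplus>\<^bsub>?K\<^esub> y) j = x j + y j" "(a \<odot>\<^bsub>?K\<^esub> x) j = a * x j" if "j < k" for x y a j
    using that by (simp_all add: ell_inf_n_def scalar_space_def)
  \<comment> \<open>\<open>H j h\<close> says that \<open>h\<close> extends the \<open>j\<close>-th
    coordinate of \<open>A\<close> after \<open>t\<close> from \<open>Z\<close> to all of
    \<open>V\<close>. In the sup norm, extending each coordinate with bound \<alpha> c keeps the
    bound for the whole vector.\<close>
  define H where "H j h \<longleftrightarrow> (\<forall>x\<in>carrier V. \<forall>y\<in>carrier V. h (x \<oplus>\<^bsub>V\<^esub> y) = h x + h y)
    \<and> (\<forall>a. \<forall>x\<in>carrier V. h (a \<odot>\<^bsub>V\<^esub> x) = a * h x)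
    \<and> (\<forall>x\<in>carrier V. norm (h x) \<le> (\<alpha> * c) * vnorm V x)
    \<and> (\<forall>x\<in>Z. h x = A (t x) j)" for j and h :: "'x \<Rightarrow> 'k"
  have "\<exists>h. H j h" if j: "j < k" for j
  proof (rule Hahn_Banach[OF V Z, of "\<alpha> * c" "\<lambda>x. A (t x) j"])
    show "0 \<le> \<alpha> * c" using \<open>0 \<le> \<alpha>\<close> \<open>0 \<le> c\<close> by simp
    show "A (t (x \<oplus>\<^bsub>V\<^esub> y)) j = A (t x) j + A (t y) j" if "x \<in> Z" "y \<in> Z" for x y
      using that j by (simp add: Z_def t_add A_add component)
    show "A (t (a \<odot>\<^bsub>V\<^esub> x)) j = a * A (t x) j" if "x \<in> Z" for a x
      using that j by (simp add: Z_def t_smult A_smult component)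
    show "norm (A (t x) j) \<le> \<alpha> * c * vnorm V x" if "x \<in> Z" for x
    proof -
      have x: "x \<in> Y" "t x \<in> F" using that by (auto simp: Z_def)
      have "norm (A (t x) j) \<le> vnorm ?K (A (t x))" by (rule norm_component_le[OF A_in[OF x(2)] j])
      also have "\<dots> \<le> \<alpha> * vnorm E (t x)" by (rule A_le[OF x(2)])
      also have "\<dots> \<le> \<alpha> * (c * vnorm V x)" using t_le[OF x(1)] \<open>0 \<le> \<alpha>\<close> by (rule mult_left_mono)
      finally show ?thesis by (simp add: mult.assoc)
    qed
  qed (unfold H_def, blast)
  then obtain f where "\<And>j. j < k \<Longrightarrow> H j (f j)" by metis
  then have f_add: "\<And>j x y. j < k \<Longrightarrow> x \<in> carrier V \<Longrightarrow> y \<in> carrier V \<Longrightarrow> f j (x \<oplus>\<^bsub>V\<^esub> y) = f j x + f j y"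
    and f_smult: "\<And>j a x. j < k \<Longrightarrow> x \<in> carrier V \<Longrightarrow> f j (a \<odot>\<^bsub>V\<^esub> x) = a * f j x"
    and f_le: "\<And>j x. j < k \<Longrightarrow> x \<in> carrier V \<Longrightarrow> norm (f j x) \<le> (\<alpha> * c) * vnorm V x"
    and f_eq: "\<And>j x. j < k \<Longrightarrow> x \<in> Z \<Longrightarrow> f j x = A (t x) j"
    by (simp_all add: H_def)
  have unit: "unit_vector k j \<in> carrier ?K" for j
    unfolding unit_vector_def by (rule restrict_in_ell_inf_n)
  have "\<exists>e. e \<in> carrier L \<and> cls e = S (unit_vector k j)" for j
    using subsetD[OF Fc S_in[OF unit]] unfolding carrier_E by (metis imageE)
  \<comment> \<open>Bounded families lifting the images under \<open>S\<close> of the unit vectors.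
    Their linear combinations are lifts for all of \<open>F\<close>.\<close>
  then obtain e where e: "\<And>j. e j \<in> carrier L" "\<And>j. cls (e j) = S (unit_vector k j)"
    by metis
  have lc_E: "lin_comb E a (\<lambda>j. cls (e j)) k = S (restrict a {..<k})" for a
    using lin_comb_operator[OF normed_space_ell_inf_n normed_ultraproduct S_E, where a = a and e = "unit_vector k" and k = k] unit
    by (simp add: e lin_comb_unit_vector)
  \<comment> \<open>Coefficients of modulus at most 1 form a vector in the unit ball of
    \<open>ell_inf_n k\<close>, on which \<open>S\<close> is bounded by \<sigma>.\<close>
  have "vnorm E (lin_comb E a (\<lambda>j. cls (e j)) k) \<le> \<sigma>" if "\<And>j. j < k \<Longrightarrow> norm (a j) \<le> 1" for a
  proof -
    have "vnorm ?K (restrict a {..<k}) \<le> 1"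
      unfolding ell_inf_n_def using that by (intro vnorm_ell_inf_le) (auto simp: scalar_space_def)
    moreover have "0 \<le> \<sigma>" unfolding \<sigma>_def by (rule opnorm_nonneg[OF normed_space_ell_inf_n Fn S])
    ultimately have "\<sigma> * vnorm ?K (restrict a {..<k}) \<le> \<sigma>" using mult_left_mono by fastforce
    moreover have "vnorm E (S (restrict a {..<k})) \<le> \<sigma> * vnorm ?K (restrict a {..<k})"
      using vnorm_le_opnorm[OF normed_space_ell_inf_n Fn S restrict_in_ell_inf_n, of a] by (simp add: \<sigma>_def)
    ultimately show ?thesis unfolding lc_E by linarith
  qed
  \<comment> \<open>The loss in passing from \<open>E\<close> to the coordinates, small enough that
    \<delta> (\<alpha> c) is at most d / 2.\<close>
  moreover define \<delta> where "\<delta> = d / (2 * (\<alpha> * c + 1))"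
  have "0 \<le> \<alpha> * c" using \<open>0 \<le> \<alpha>\<close> \<open>0 \<le> c\<close> by simp
  then have "0 < \<delta>" using \<open>0 < d\<close> by (simp add: \<delta>_def)
  ultimately have ev: "eventually (\<lambda>i. \<forall>a. (\<forall>j<k. norm (a j) \<le> 1)
      \<longrightarrow> vnorm (X i) (lin_comb (X i) a (\<lambda>j. e j i) k) \<le> \<sigma> + \<delta>) U"
    by (intro eventually_uniform_bound[of k e \<sigma> "\<sigma> + \<delta>"]) (use e in auto)
  \<comment> \<open>The two losses of d / 2 meet here: one from the product \<alpha> \<sigma>
    exceeding \<open>r\<close>, the other from \<delta>.\<close>
  have const: "(\<sigma> + \<delta>) * (\<alpha> * c) \<le> r * c + d"
  proof -
    have "\<alpha> * \<sigma> * c \<le> (r + d / (2 * (c + 1))) * c"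
      using less \<open>0 \<le> c\<close> by (intro mult_right_mono) (auto simp: \<alpha>_def \<sigma>_def)
    also have "\<dots> \<le> r * c + d / 2"
      using \<open>0 \<le> c\<close> \<open>0 < d\<close> by (simp add: field_simps)
    finally have "\<sigma> * (\<alpha> * c) \<le> r * c + d / 2" by (simp add: ac_simps)
    moreover have "\<delta> * (\<alpha> * c) \<le> d / 2"
      using \<open>0 \<le> \<alpha> * c\<close> \<open>0 < d\<close> by (simp add: \<delta>_def field_simps)
    ultimately show ?thesis by (simp add: distrib_right)
  qed
  \<comment> \<open>The extended coordinates of \<open>x\<close> combined with the lifted vectors;
    linearity is inherited from the functionals f j.\<close>
  define \<tau> where "\<tau> i x = lin_comb (X i) (\<lambda>j. f j x) (\<lambda>j. e j i) k" for i x
  have ei: "e j i \<in> carrier (X i)" if "i \<in> I" for i j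
    by (rule ell_inf_component[OF e(1) that])
  show ?thesis
  proof (intro exI[of _ \<tau>] conjI ballI allI impI)
    fix i assume i: "i \<in> I"
    interpret Xi: normed_space "X i" by (rule normed[OF i])
    fix x assume x: "x \<in> carrier V"
    show "\<tau> i x \<in> carrier (X i)" unfolding \<tau>_def using ei[OF i] by (intro Xi.lin_comb_closed)
    show "\<tau> i (a \<odot>\<^bsub>V\<^esub> x) = a \<odot>\<^bsub>X i\<^esub> \<tau> i x" for a
    proof -
      have "\<tau> i (a \<odot>\<^bsub>V\<^esub> x) = lin_comb (X i) (\<lambda>j. a * f j x) (\<lambda>j. e j i) k"
        unfolding \<tau>_def using f_smult x by (intro lin_comb_cong) auto
      then show ?thesis using Xi.lin_comb_smult ei[OF i] by (simp add: \<tau>_def)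
    qed
    fix y assume y: "y \<in> carrier V"
    have "\<tau> i (x \<oplus>\<^bsub>V\<^esub> y) = lin_comb (X i) (\<lambda>j. f j x + f j y) (\<lambda>j. e j i) k"
      unfolding \<tau>_def using f_add x y by (intro lin_comb_cong) auto
    then show "\<tau> i (x \<oplus>\<^bsub>V\<^esub> y) = \<tau> i x \<oplus>\<^bsub>X i\<^esub> \<tau> i y"
      using Xi.lin_comb_add ei[OF i] by (simp add: \<tau>_def)
  next
    show "eventually (\<lambda>i. \<forall>x\<in>carrier V. vnorm (X i) (\<tau> i x)
        \<le> (r * opnorm (subspace_of V Y) E t + d) * vnorm V x) U"
      using ev eventually_in_I
    proof eventually_elim
      case (elim i)
      interpret Xi: normed_space "X i" by (rule normed[OF elim(2)])
      show ?case
      proof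
        fix x assume x: "x \<in> carrier V"
        have nn: "0 \<le> vnorm V x" by (rule V.vnorm_nonneg[OF x])
        have "vnorm (X i) (\<tau> i x) \<le> (\<sigma> + \<delta>) * ((\<alpha> * c) * vnorm V x)"
          unfolding \<tau>_def
          by (rule Xi.vnorm_lin_comb_scale)
            (use ei[OF elim(2)] elim(1) f_le x nn \<open>0 \<le> \<alpha> * c\<close> in auto)
        also have "\<dots> \<le> (r * c + d) * vnorm V x"
          using mult_right_mono[OF const nn] by (simp add: mult.assoc)
        finally show "vnorm (X i) (\<tau> i x) \<le> (r * opnorm (subspace_of V Y) E t + d) * vnorm V x"
          by (simp add: c_def)
      qed
    qed
  next
    fix y z and d :: real
    assume y: "y \<in> D" and z: "z \<in> carrier L" "cls z = t y" and "0 < d"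
    \<comment> \<open>On \<open>Z\<close> the functionals f j give the coordinates of
      \<open>A (t y)\<close>, and \<open>S\<close> undoes \<open>A\<close>, so the combination of
      lifts represents \<open>t y\<close>.\<close>
    have yZ: "y \<in> Z" using y D F by (auto simp: Z_def)
    let ?w = "lin_comb L (\<lambda>j. f j y) e k"
    have w: "?w \<in> carrier L" using e by (intro L.lin_comb_closed)
    have "A (t y) \<in> extensional {..<k}"
      using A_in[of "t y"] yZ unfolding ell_inf_n_def by (intro ell_inf_extensional) (auto simp: Z_def)
    then have "restrict (\<lambda>j. f j y) {..<k} = A (t y)"
      using f_eq[OF _ yZ] by (intro extensionalityI[of _ "{..<k}"]) auto
    then have "cls ?w = t y"
      using lin_comb_cls[of k e "\<lambda>j. f j y"] e(1) lc_E[of "\<lambda>j. f j y"] SA[of "t y"] yZ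
      by (simp add: Z_def)
    then have "eventually (\<lambda>i. vnorm (X i) (?w i \<ominus>\<^bsub>X i\<^esub> z i) < d) U"
      using cls_eq_iff[OF w z(1)] z(2) \<open>0 < d\<close> by simp
    with eventually_in_I show "eventually (\<lambda>i. vnorm (X i) (\<tau> i y \<ominus>\<^bsub>X i\<^esub> z i) < d) U"
      by eventually_elim (simp add: \<tau>_def lin_comb_ell_inf)
  qed
qed

end

section \<open>Extension from separable subspaces\<close>

context normed_ultraproduct
begin

lemma separable_extension:
  fixes V :: "('k, 'x) nspace"
  assumes V: "normed_space V" and Y: "closed_subspace Y V"
    and sep: "separable_space (subtopology (vtopology V) Y)"
    and t: "operator (subspace_of V Y) E t" and LE: "script_L_inf_plus r E"
    and r: "0 \<le> r" and incomplete: "countably_incomplete I U"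
  shows "\<exists>T. operator V E T \<and> (\<forall>y\<in>Y. T y = t y) \<and> opnorm V E T \<le> r * opnorm (subspace_of V Y) E t"
proof -
  interpret V: normed_space V by fact
  have Ysub: "submodule Y scalar_ring V" using Y by (simp add: closed_subspace_def)
  have Yc: "Y \<subseteq> carrier V" using Ysub by (simp add: V.submodule_iff)
  have Y_add: "\<And>x y. x \<in> Y \<Longrightarrow> y \<in> Y \<Longrightarrow> x \<oplus>\<^bsub>V\<^esub> y \<in> Y" and Y_smult: "\<And>a x. x \<in> Y \<Longrightarrow> a \<odot>\<^bsub>V\<^esub> x \<in> Y"
    using Ysub by (auto simp: V.submodule_iff)
  have Yn: "normed_space (subspace_of V Y)" by (rule V.normed_space_subspace[OF Ysub])
  define c where "c = opnorm (subspace_of V Y) E t"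
  have "0 \<le> c" unfolding c_def by (rule opnorm_nonneg[OF Yn normed_ultraproduct t])
  have t_in: "\<And>y. y \<in> Y \<Longrightarrow> t y \<in> carrier E"
    and t_add: "\<And>x y. x \<in> Y \<Longrightarrow> y \<in> Y \<Longrightarrow> t (x \<oplus>\<^bsub>V\<^esub> y) = t x \<oplus>\<^bsub>E\<^esub> t y"
    and t_smult: "\<And>a x. x \<in> Y \<Longrightarrow> t (a \<odot>\<^bsub>V\<^esub> x) = a \<odot>\<^bsub>E\<^esub> t x"
    using t by (auto simp: operator_def)
  have t_le: "vnorm E (t y) \<le> c * vnorm V y" if "y \<in> Y" for y
    using vnorm_le_opnorm[OF Yn normed_ultraproduct t, of y] that by (simp add: c_def)
  obtain y :: "nat \<Rightarrow> 'x" where y: "\<And>n. y n \<in> Y" and dense: "\<And>z e. z \<in> Y \<Longrightarrow> 0 < e \<Longrightarrow> \<exists>n. vnorm V (z \<ominus>\<^bsub>V\<^esub> y n) < e"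
  proof (rule V.separable_subspaceE[OF Y sep])
  qed (rule that)
  have "\<exists>z. z \<in> carrier L \<and> cls z = t (y n)" for n
    using t_in[OF y] unfolding carrier_E by (metis imageE)
  \<comment> \<open>One representative of each \<open>t (y n)\<close>, common to all stages.\<close>
  then obtain z where z: "\<And>n. z n \<in> carrier L" "\<And>n. cls (z n) = t (y n)"
    by metis
  \<comment> \<open>The shift by one keeps the tolerance defined and at most 1 from stage 0
    on.\<close>
  define d where "d n = inverse (real (Suc n))" for n
  have d: "0 < d n" "d n \<le> 1" for n by (auto simp: d_def field_simps)
  have d_mono: "d n \<le> d m" if "m \<le> n" for m n
    using that by (simp add: d_def field_simps)
  define lin where "lin i \<tau> \<longleftrightarrow> (\<forall>x\<in>carrier V. \<tau> x \<in> carrier (X i))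
      \<and> (\<forall>x\<in>carrier V. \<forall>y\<in>carrier V. \<tau> (x \<oplus>\<^bsub>V\<^esub> y) = \<tau> x \<oplus>\<^bsub>X i\<^esub> \<tau> y)
      \<and> (\<forall>c. \<forall>x\<in>carrier V. \<tau> (c \<odot>\<^bsub>V\<^esub> x) = c \<odot>\<^bsub>X i\<^esub> \<tau> x)" for i \<tau>
  define bounded where "bounded n i \<tau> \<longleftrightarrow> (\<forall>x\<in>carrier V. vnorm (X i) (\<tau> x) \<le> (r * c + d n) * vnorm V x)" for n i \<tau>
  define close where "close n i \<tau> \<longleftrightarrow> (\<forall>m\<in>{..n}. vnorm (X i) (\<tau> (y m) \<ominus>\<^bsub>X i\<^esub> z m i) < d n)" for n i \<tau>
  have "\<exists>\<tau>. (\<forall>i\<in>I. lin i (\<tau> i)) \<and> eventually (\<lambda>i. bounded n i (\<tau> i)) U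
    \<and> eventually (\<lambda>i. close n i (\<tau> i)) U" for n
  proof -
    have sub: "y ` {..n} \<subseteq> Y" using y by auto
    have "\<exists>\<tau>. (\<forall>i\<in>I. lin i (\<tau> i)) \<and> eventually (\<lambda>i. bounded n i (\<tau> i)) U
      \<and> (\<forall>w\<in>y ` {..n}. \<forall>z\<in>carrier L. cls z = t w
        \<longrightarrow> (\<forall>d>0. eventually (\<lambda>i. vnorm (X i) (\<tau> i w \<ominus>\<^bsub>X i\<^esub> z i) < d) U))"
      unfolding lin_def bounded_def c_def
      by (rule finite_approximation[OF V Ysub t LE finite_imageI[OF finite_atMost] sub d(1)])
    then obtain \<tau> where "\<forall>i\<in>I. lin i (\<tau> i)" "eventually (\<lambda>i. bounded n i (\<tau> i)) U"
      and \<tau>: "\<forall>w\<in>y ` {..n}. \<forall>z\<in>carrier L. cls z = t w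
        \<longrightarrow> (\<forall>d>0. eventually (\<lambda>i. vnorm (X i) (\<tau> i w \<ominus>\<^bsub>X i\<^esub> z i) < d) U)"
      by blast
    moreover have "eventually (\<lambda>i. close n i (\<tau> i)) U"
      unfolding close_def using \<tau> z d by (intro eventually_ball_finite) auto
    ultimately show ?thesis by blast
  qed
  then obtain \<tau> where \<tau>: "\<And>n i. i \<in> I \<Longrightarrow> lin i (\<tau> n i)" "\<And>n. eventually (\<lambda>i. bounded n i (\<tau> n i)) U"
    "\<And>n. eventually (\<lambda>i. close n i (\<tau> n i)) U"
    by metis
  obtain J :: "nat \<Rightarrow> 'i set" where J: "\<And>n. eventually (\<lambda>i. i \<in> J n) U" "(\<Inter>n. J n) = {}"
    using incomplete by (auto simp: countably_incomplete_def)
  \<comment> \<open>The condition on \<open>J n\<close> makes every index fail at some stage, since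
    the \<open>J n\<close> have empty intersection.\<close>
  define good where "good n i \<longleftrightarrow> i \<in> J n \<and> bounded n i (\<tau> n i) \<and> close n i (\<tau> n i)" for n i
  have ev_good: "eventually (good n) U" for n
    using J(1)[of n] \<tau>(2)[of n] \<tau>(3)[of n] by eventually_elim (simp add: good_def)
  \<comment> \<open>The first failing stage, which exists by \<open>M\<close>. All earlier stages
    succeed, and \<open>ev_M\<close> says that this number tends to infinity along
    \<open>U\<close>.\<close>
  define M where "M i = (LEAST n. \<not> good n i)" for i
  have M: "\<not> good (M i) i" for i
  proof -
    obtain n where "i \<notin> J n" using J(2) by blast
    then have "\<not> good n i" by (simp add: good_def)
    then show ?thesis unfolding M_def by (rule LeastI)
  qed
  have goodM: "good n i" if "n < M i" for n i
    using that not_less_Least unfolding M_def by blast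
  have ev_M: "eventually (\<lambda>i. n < M i) U" for n
  proof -
    have "eventually (\<lambda>i. \<forall>m\<in>{..n}. good m i) U"
      using ev_good by (intro eventually_ball_finite) auto
    then show ?thesis
      by eventually_elim (metis M atMost_iff not_le)
  qed
  \<comment> \<open>Index \<open>i\<close> uses its last stage before the first failure, M i - 1. If
    stage 0 already fails, the zero map keeps linearity and boundedness.\<close>
  define \<sigma> where "\<sigma> i = (case M i of 0 \<Rightarrow> (\<lambda>x. \<zero>\<^bsub>X i\<^esub>) | Suc n \<Rightarrow> \<tau> n i)" for i
  have lin: "lin i (\<sigma> i)" if "i \<in> I" for i
  proof -
    interpret Xi: normed_space "X i" by (rule normed[OF that])
    show ?thesis using \<tau>(1)[OF that] by (auto simp: \<sigma>_def lin_def split: nat.split)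
  qed
  \<comment> \<open>The stage used is at least \<open>n\<close>, its tolerance is no larger and it
    treats at least the points up to \<open>n\<close>, so it satisfies the requirements of stage
    \<open>n\<close>.\<close>
  have \<sigma>_M: "bounded n i (\<sigma> i) \<and> close n i (\<sigma> i)" if less: "n < M i" for n i
  proof -
    obtain p where p: "M i = Suc p" "n \<le> p" using less by (cases "M i") auto
    have "good p i" using goodM p by simp
    moreover have "\<sigma> i = \<tau> p i" by (simp add: \<sigma>_def p)
    ultimately have "bounded p i (\<sigma> i)" "close p i (\<sigma> i)" by (simp_all add: good_def)
    moreover have "(r * c + d p) * vnorm V x \<le> (r * c + d n) * vnorm V x" if "x \<in> carrier V" for x
      using that d_mono[OF p(2)] by (intro mult_right_mono) auto
    ultimately show ?thesis
      using d_mono[OF p(2)] p(2) unfolding bounded_def close_def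
      by (meson atMost_iff order_trans less_le_trans)
  qed
  have \<sigma>_in: "\<And>i x. i \<in> I \<Longrightarrow> x \<in> carrier V \<Longrightarrow> \<sigma> i x \<in> carrier (X i)"
    and \<sigma>_add: "\<And>i x y. i \<in> I \<Longrightarrow> x \<in> carrier V \<Longrightarrow> y \<in> carrier V \<Longrightarrow> \<sigma> i (x \<oplus>\<^bsub>V\<^esub> y) = \<sigma> i x \<oplus>\<^bsub>X i\<^esub> \<sigma> i y"
    and \<sigma>_smult: "\<And>i a x. i \<in> I \<Longrightarrow> x \<in> carrier V \<Longrightarrow> \<sigma> i (a \<odot>\<^bsub>V\<^esub> x) = a \<odot>\<^bsub>X i\<^esub> \<sigma> i x"
    using lin by (simp_all add: lin_def)
  \<comment> \<open>A bound at every index of \<open>I\<close>, not only along \<open>U\<close>, is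
    needed for the family to lie in \<open>L\<close>; when M i > 0 it comes from stage 0, where d 0
    = 1.\<close>
  have \<sigma>_le: "vnorm (X i) (\<sigma> i x) \<le> (r * c + 1) * vnorm V x" if "i \<in> I" "x \<in> carrier V" for i x
  proof -
    interpret Xi: normed_space "X i" by (rule normed[OF that(1)])
    have nn: "0 \<le> vnorm V x" using that by simp
    show ?thesis
    proof (cases "M i")
      case 0
      then show ?thesis using nn r \<open>0 \<le> c\<close> by (simp add: \<sigma>_def)
    next
      case (Suc n)
      then have "vnorm (X i) (\<sigma> i x) \<le> (r * c + d 0) * vnorm V x"
        using \<sigma>_M[of 0 i] that by (simp add: bounded_def)
      then show ?thesis by (simp add: d_def)
    qed
  qed
  define W where "W x = (\<lambda>i\<in>I. \<sigma> i x)" for x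
  have W: "W x \<in> carrier L" if "x \<in> carrier V" for x
    using that \<sigma>_in \<sigma>_le by (intro ell_infI) (auto simp: W_def)
  define T where "T x = cls (W x)" for x
  have T_in: "T x \<in> carrier E" if "x \<in> carrier V" for x
    unfolding T_def by (intro cls_in W that)
  have T_add: "T (x \<oplus>\<^bsub>V\<^esub> y) = T x \<oplus>\<^bsub>E\<^esub> T y" if "x \<in> carrier V" "y \<in> carrier V" for x y
  proof -
    have "W (x \<oplus>\<^bsub>V\<^esub> y) = W x \<oplus>\<^bsub>L\<^esub> W y"
      using that \<sigma>_add by (auto simp: W_def intro!: restrict_ext)
    then show ?thesis unfolding T_def using cls_add[OF W W] that by metis
  qed
  have T_smult: "T (a \<odot>\<^bsub>V\<^esub> x) = a \<odot>\<^bsub>E\<^esub> T x" if "x \<in> carrier V" for a x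
  proof -
    have "W (a \<odot>\<^bsub>V\<^esub> x) = a \<odot>\<^bsub>L\<^esub> W x"
      using that \<sigma>_smult by (auto simp: W_def intro!: restrict_ext)
    then show ?thesis unfolding T_def using cls_smult[OF W] that by metis
  qed
  have T_le: "vnorm E (T x) \<le> (r * c) * vnorm V x" if x: "x \<in> carrier V" for x
  proof -
    have "vnorm E (T x) \<le> (r * c + d n) * vnorm V x" for n
      unfolding T_def
    proof (rule vnorm_cls_le[OF W[OF x]])
      show "0 \<le> (r * c + d n) * vnorm V x" using x r \<open>0 \<le> c\<close> d(1)[of n] by simp
      show "eventually (\<lambda>i. vnorm (X i) (W x i) \<le> (r * c + d n) * vnorm V x) U"
        using ev_M[of n] eventually_in_I
        by eventually_elim (use \<sigma>_M x in \<open>auto simp: W_def bounded_def\<close>)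
    qed
    \<comment> \<open>The estimate holds for every \<open>n\<close>, so the limit removes the
      tolerance and leaves the exact constant.\<close>
    moreover have "(\<lambda>n. (r * c + d n) * vnorm V x) \<longlonglongrightarrow> (r * c + 0) * vnorm V x"
      unfolding d_def by (intro tendsto_intros LIMSEQ_inverse_real_of_nat)
    ultimately show ?thesis using LIMSEQ_le_const[of _ _ "vnorm E (T x)"] by fastforce
  qed
  have T_y: "T (y m) = t (y m)" for m
  proof -
    have "eventually (\<lambda>i. vnorm (X i) (W (y m) i \<ominus>\<^bsub>X i\<^esub> z m i) < e) U" if pos: "e > 0" for e
    proof -
      obtain n where n: "d n < e" using reals_Archimedean[OF pos] by (auto simp: d_def)
      \<comment> \<open>A stage late enough both to include the point \<open>y m\<close> and to have
        tolerance below \<open>e\<close>.\<close>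
      define p where "p = max m n"
      have "d p < e" using n d_mono[of n p] by (simp add: p_def)
      show ?thesis
        using ev_M[of p] eventually_in_I
      proof eventually_elim
        case (elim i)
        have "vnorm (X i) (\<sigma> i (y m) \<ominus>\<^bsub>X i\<^esub> z m i) < d p"
          using \<sigma>_M[OF elim(1)] by (auto simp: close_def p_def)
        with \<open>d p < e\<close> elim(2) show ?case by (simp add: W_def)
      qed
    qed
    then have "cls (W (y m)) = cls (z m)"
      using cls_eq_iff[OF W z(1)] y Yc by blast
    then show ?thesis by (simp add: T_def z)
  qed
  have "T x = t x" if x: "x \<in> Y" for x
  proof -
    have xc: "x \<in> carrier V" and yc: "y n \<in> carrier V" for n using x y Yc by auto
    have Ex: "T x \<in> carrier E" "t x \<in> carrier E" using T_in[OF xc] t_in[OF x] by auto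
    \<comment> \<open>\<open>T\<close> and \<open>t\<close> agree at the dense points and both are
      bounded, so their difference at \<open>x\<close> is controlled by the distance to such a
      point. The summand 1 makes the constant a valid divisor below.\<close>
    have le: "vnorm E (T x \<ominus>\<^bsub>E\<^esub> t x) \<le> (r * c + c + 1) * e" if "e > 0" for e
    proof -
      obtain n where n: "vnorm V (x \<ominus>\<^bsub>V\<^esub> y n) < e" using dense[OF x \<open>e > 0\<close>] by blast
      have diff_in: "x \<ominus>\<^bsub>V\<^esub> y n \<in> Y"
        using x y by (simp add: V.minus_eq_smult[OF yc] Y_add Y_smult)
      then have diff_c: "x \<ominus>\<^bsub>V\<^esub> y n \<in> carrier V" using Yc by blast
      have Ey: "t (y n) \<in> carrier E" by (rule t_in[OF y])
      have 1: "T (x \<ominus>\<^bsub>V\<^esub> y n) = T x \<ominus>\<^bsub>E\<^esub> t (y n)"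
        using Ey xc yc by (simp add: V.minus_eq_smult E.minus_eq_smult T_add T_smult T_y)
      have 2: "t (x \<ominus>\<^bsub>V\<^esub> y n) = t x \<ominus>\<^bsub>E\<^esub> t (y n)"
        using Ey x y yc by (simp add: V.minus_eq_smult E.minus_eq_smult t_add t_smult Y_smult)
      have "T x \<ominus>\<^bsub>E\<^esub> t x = T (x \<ominus>\<^bsub>V\<^esub> y n) \<ominus>\<^bsub>E\<^esub> t (x \<ominus>\<^bsub>V\<^esub> y n)"
        unfolding 1 2 by (rule E.minus_minus_minus[OF Ex Ey, symmetric])
      also have "vnorm E \<dots> \<le> vnorm E (T (x \<ominus>\<^bsub>V\<^esub> y n)) + vnorm E (t (x \<ominus>\<^bsub>V\<^esub> y n))"
        by (rule E.vnorm_minus_triangle[OF T_in[OF diff_c] t_in[OF diff_in]])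
      also have "\<dots> \<le> (r * c) * vnorm V (x \<ominus>\<^bsub>V\<^esub> y n) + c * vnorm V (x \<ominus>\<^bsub>V\<^esub> y n)"
        by (intro add_mono T_le t_le diff_in diff_c)
      also have "\<dots> = (r * c + c) * vnorm V (x \<ominus>\<^bsub>V\<^esub> y n)" by (simp add: distrib_right)
      also have "\<dots> \<le> (r * c + c + 1) * e"
        using n r \<open>0 \<le> c\<close> V.vnorm_nonneg[OF diff_c] by (intro mult_mono) auto
      finally show ?thesis .
    qed
    have pos: "0 < r * c + c + 1" using r \<open>0 \<le> c\<close> by (simp add: add_nonneg_pos)
    have "vnorm E (T x \<ominus>\<^bsub>E\<^esub> t x) \<le> 0 + e" if "e > 0" for e
      using le[of "e / (r * c + c + 1)"] that pos by simp
    then have norm_0: "vnorm E (T x \<ominus>\<^bsub>E\<^esub> t x) \<le> 0" by (rule field_le_epsilon)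
    have diff_in: "T x \<ominus>\<^bsub>E\<^esub> t x \<in> carrier E" by (rule E.minus_closed[OF Ex])
    have "vnorm E (T x \<ominus>\<^bsub>E\<^esub> t x) = 0"
      by (rule order.antisym[OF norm_0 E.vnorm_nonneg[OF diff_in]])
    then have "T x \<ominus>\<^bsub>E\<^esub> t x = \<zero>\<^bsub>E\<^esub>" using E.vnorm_eq_0_iff[OF diff_in] by simp
    then show ?thesis using Ex by (simp add: E.minus_eq_0_iff)
  qed
  moreover have "operator V E T"
    unfolding operator_def
  proof (intro conjI exI[of _ "r * c"] ballI allI)
  qed (use T_in T_add T_smult T_le in auto)
  moreover have "opnorm V E T \<le> r * c"
    using r \<open>0 \<le> c\<close> by (intro opnorm_le[OF V] T_le) auto
  ultimately show ?thesis unfolding c_def by blast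
qed

end

theorem theorem4p9:
  fixes I :: "'i set"
    and U :: "'i filter"
    and r :: real
    and X :: "'i \<Rightarrow> ('k::real_or_complex, 'v) nspace"
  assumes "ultrafilter_on I U"
    and "countably_incomplete I U"
    and "r \<ge> 1"
    and "\<And>i. i \<in> I \<Longrightarrow> banach_space (X i)"
    and "script_L_inf_plus r (ultraproduct U I X)"
  shows "universally_separably_injective TYPE('x) r (ultraproduct U I X)"
proof -
  \<comment> \<open>Any constant above \<open>r\<close> would do; the aim is to read off that the
    ultraproduct is a Banach space.\<close>
  have "script_L_inf (r + 1) (ultraproduct U I X)"
    using assms(5) by (simp add: script_L_inf_plus_def)
  then have E: "banach_space (ultraproduct U I X)" by (simp add: script_L_inf_def)
  interpret normed_ultraproduct I U X
    using assms(1,4) E by (intro normed_ultraproduct.intro) (auto simp: banach_space_def)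
  show ?thesis
    unfolding universally_separably_injective_def
  proof (intro conjI allI impI E, elim conjE)
    fix V :: "('k, 'x) nspace" and Y t
    assume "banach_space V" "closed_subspace Y V" "separable_space (subtopology (vtopology V) Y)"
      "operator (subspace_of V Y) (ultraproduct U I X) t"
    with assms show "\<exists>T. operator V (ultraproduct U I X) T \<and> (\<forall>y\<in>Y. T y = t y) \<and>
        opnorm V (ultraproduct U I X) T \<le> r * opnorm (subspace_of V Y) (ultraproduct U I X) t"
      by (intro separable_extension) (auto simp: banach_space_def)
  qed
qed

end
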